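(* Let $X$ be a semilocally 2-connected topological space. For $[h]$ ranging over the 2-tracks of $X$ and $(U_0,U_1,V_0,V_1)$ over all admissible quadruples for $[h]$, the sets $\langle [h],U_0,U_1,V_0,V_1\rangle$ form an open neighbourhood basis for $\Pi_2(X)_2$; that is, there is a (unique) topology on the set $\Pi_2(X)_2$ of 2-tracks in which all these sets are open and in which, for every $[h]$, the sets $\langle [h],U_0,U_1,V_0,V_1\rangle$ form a neighbourhood basis at $[h]$.
   Context: **Spaces and 2-tracks.** $I=[0,1]$. A space $X$ is *semilocally 2-connected* if every point has a neighbourhood basis of open simply-connected (in particular path-connected) sets $U$ such that the inclusion induces the zero map $\pi_2(U,u)\to\pi_2(X,u)$ for every $u\in U$. Such open sets $U\subset X$ are called *basic open*. $X^I$ has the compact-open topology. A *bigon* is a continuous map $f\colon I^2\to X$, $(s,t)\mapsto f(s,t)$, that is constant on $\{0\}\times I$ and on $\{1\}\times I$. A *2-track* $[f]$ is a homotopy class of bigons relative to $\partial I^2$; $\Pi_2(X)_2$ is the set of 2-tracks. Put $s_1[f]=f(\cdot,0)$, $t_1[f]=f(\cdot,1)\in X^I$, $s_0[f]=f(0,0)$, $t_0[f]=f(1,0)\in X$. If $t_1[f]=s_1[g]$, then $[g]+[f]=[g+f]$ is the class of the bigon equal to $f(s,2t)$ for $t\le 1/2$ and $g(s,2t-1)$ for $t\geq 1/2$. If $t_0[f]=s_0[g]$, then $g\bullet f$ is the bigon equal to $f(2s,t)$ for $s\le 1/2$ and $g(2s-1,t)$ for $s\ge 1/2$. For a path $\beta$,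 $\mathrm{id}_\beta$ denotes the bigon $(s,t)\mapsto\beta(s)$. **Basic open sets of $X^I$.** For $n\ge 0$, a partition $\mathfrak p=\{0<a_1<\dots<a_{2n}<1\}$ (with $a_0=0$, $a_{2n+1}=1$) and basic open sets $\mathcal W=\{W_i\}_{i=1}^{2n+1}$ with $W_{2i}\subset W_{2i-1}\cap W_{2i+1}$ for $i=1,\dots,n$, let $N(\mathfrak p,\mathcal W)=\{\eta\in X^I\mid \eta([a_{i-1},a_i])\subset W_i,\ i=1,\dots,2n+1\}$. The sets $N(\mathfrak p,\mathcal W)$ containing $\gamma$ form a neighbourhood basis at $\gamma$ in $X^I$; they are called basic open neighbourhoods of $\gamma$. **The sets $\langle [h],U_0,U_1,V_0,V_1\rangle$.** Let $[h]$ be a 2-track. A quadruple $(U_0,U_1,V_0,V_1)$ is *admissible* for $[h]$ if $V_0=N(\mathfrak p_0,\{W^{(0)}_i\}_{i=1}^{n_0})$ and $V_1=N(\mathfrak p_1,\{W^{(1)}_i\}_{i=1}^{n_1})$ are basic open neighbourhoods of $s_1[h]$ and $t_1[h]$, and $U_0\ni s_0[h]$, $U_1\ni t_0[h]$ are basic open sets of $X$ with $U_0\subset W^{(0)}_1\cap W^{(1)}_1$ and $U_1\subset W^{(0)}_{n_0}\cap W^{(1)}_{n_1}$. Define $\langle [h],U_0,U_1,V_0,V_1\rangle\subset\Pi_2(X)_2$ to be the set of those $[f]$ for which there exist paths $\beta_\epsilon\colon I\to U_\epsilon$ and bigons $\lambda_\epsilon$ with $\lambda_\epsilon(\cdot,t)\in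 V_\epsilon$ for all $t\in I$ (that is, $\lambda_\epsilon$ corresponds to a path $I\to V_\epsilon$), $\epsilon=0,1$, such that $[f]=[\lambda_1+(\mathrm{id}_{\beta_1}\bullet(h\bullet\mathrm{id}_{\beta_0}))+\lambda_0]$ (in particular the compositions are defined, so $\beta_0(1)=s_0[h]$ and $\beta_1(0)=t_0[h]$).
   Formalization: With both whiskerings broken at s=1/2 the set can be empty (X=ℝ, h(s,t)=s), so the claim fails; here β₀, h, β₁ are joined at break points δ and 1−δ, and [f] must have such a form for all sufficiently small δ>0, with β₀, β₁ fixed and λ₀, λ₁ allowed to depend on δ. *)

theory Defs
  imports "HOL-Analysis.Analysis"
begin

text \<open>A space is a set \<open>X\<close> in a topological type, with the subspace topology (\<open>X = UNIV\<close>
  is the whole type). Paths and bigons are functions on \<open>real\<close> and \<open>real \<times> real\<close> of which only the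
  restriction to \<open>{0..1}\<close> and \<open>{0..1} \<times> {0..1}\<close> matters; bigons are applied to \<open>(s, t)\<close>.\<close>

abbreviation unit_square :: "(real \<times> real) set"
  where "unit_square \<equiv> {0..1} \<times> {0..1}"

definition square_boundary :: "(real \<times> real) set"
  where "square_boundary = {0,1} \<times> {0..1} \<union> {0..1} \<times> {0,1}"

text \<open>The homotopy class of \<open>f\<close> relative to the boundary of the square. Values outside the square
  are unconstrained, so a class contains every function that agrees with \<open>f\<close> on the square.\<close>

definition square_class :: "'a::topological_space set \<Rightarrow> (real \<times> real \<Rightarrow> 'a) \<Rightarrow> (real \<times> real \<Rightarrow> 'a) set"
  where "square_class X f =
    {g. homotopic_with_canon (\<lambda>k. \<forall>z\<in>square_boundary. k z = f z) unit_square X f g}"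

definition pi2 :: "'a::topological_space set \<Rightarrow> 'a \<Rightarrow> (real \<times> real \<Rightarrow> 'a) set set"
  where "pi2 X u = square_class X `
    {f. continuous_on unit_square f \<and> f ` unit_square \<subseteq> X \<and> (\<forall>z\<in>square_boundary. f z = u)}"

text \<open>The map induced on \<open>\<pi>\<^sub>2\<close> by an inclusion into \<open>X\<close>: the union of the \<open>X\<close>-classes of the
  representatives, all of which coincide.\<close>

definition pi2_inclusion :: "'a::topological_space set \<Rightarrow> (real \<times> real \<Rightarrow> 'a) set \<Rightarrow> (real \<times> real \<Rightarrow> 'a) set"
  where "pi2_inclusion X c = (\<Union>f\<in>c. square_class X f)"

definition pi2_zero :: "'a::topological_space set \<Rightarrow> 'a \<Rightarrow> (real \<times> real \<Rightarrow> 'a) set"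
  where "pi2_zero X u = square_class X (\<lambda>_. u)"

definition basic_open :: "'a::topological_space set \<Rightarrow> 'a set \<Rightarrow> bool"
  where "basic_open X U \<longleftrightarrow> openin (top_of_set X) U \<and> simply_connected U \<and>
    (\<forall>u\<in>U. \<forall>c\<in>pi2 U u. pi2_inclusion X c = pi2_zero X u)"

definition semilocally_2_connected :: "'a::topological_space set \<Rightarrow> bool"
  where "semilocally_2_connected X \<longleftrightarrow>
    (\<forall>x\<in>X. \<forall>G. openin (top_of_set X) G \<and> x \<in> G \<longrightarrow> (\<exists>U. basic_open X U \<and> x \<in> U \<and> U \<subseteq> G))"

definition bigon :: "'a::topological_space set \<Rightarrow> (real \<times> real \<Rightarrow> 'a) \<Rightarrow> bool"
  where "bigon X f \<longleftrightarrow> continuous_on unit_square f \<and> f ` unit_square \<subseteq> X \<and>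
    f constant_on {0} \<times> {0..1} \<and> f constant_on {1} \<times> {0..1}"

definition two_tracks :: "'a::topological_space set \<Rightarrow> (real \<times> real \<Rightarrow> 'a) set set"
  where "two_tracks X = square_class X ` {f. bigon X f}"

definition src1 :: "(real \<times> real \<Rightarrow> 'a) \<Rightarrow> real \<Rightarrow> 'a"
  where "src1 f = (\<lambda>s. f (s, 0))"

definition tgt1 :: "(real \<times> real \<Rightarrow> 'a) \<Rightarrow> real \<Rightarrow> 'a"
  where "tgt1 f = (\<lambda>s. f (s, 1))"

definition src0 :: "(real \<times> real \<Rightarrow> 'a) \<Rightarrow> 'a"
  where "src0 f = f (0, 0)"

definition tgt0 :: "(real \<times> real \<Rightarrow> 'a) \<Rightarrow> 'a"
  where "tgt0 f = f (1, 0)"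

definition id_bigon :: "(real \<Rightarrow> 'a) \<Rightarrow> real \<times> real \<Rightarrow> 'a"
  where "id_bigon \<beta> = (\<lambda>(s, t). \<beta> s)"

definition vcomposable :: "(real \<times> real \<Rightarrow> 'a) \<Rightarrow> (real \<times> real \<Rightarrow> 'a) \<Rightarrow> bool"
  where "vcomposable g f \<longleftrightarrow> (\<forall>s\<in>{0..1}. tgt1 f s = src1 g s)"

text \<open>\<open>g + f\<close>: first \<open>f\<close>, then \<open>g\<close>.\<close>

definition vcomp :: "(real \<times> real \<Rightarrow> 'a) \<Rightarrow> (real \<times> real \<Rightarrow> 'a) \<Rightarrow> real \<times> real \<Rightarrow> 'a"
  where "vcomp g f = (\<lambda>(s, t). if t \<le> 1/2 then f (s, 2 * t) else g (s, 2 * t - 1))"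

text \<open>The horizontal composite \<open>g \<bullet> f\<close> with break point \<open>c\<close>, for \<open>0 < c < 1\<close>: first \<open>f\<close> on
  \<open>[0, c]\<close>, then \<open>g\<close> on \<open>[c, 1]\<close>. The usual composite has \<open>c = 1/2\<close>; other values of \<open>c\<close> give the
  same composite up to a reparametrization of the interval.\<close>

definition hcomp_at :: "real \<Rightarrow> (real \<times> real \<Rightarrow> 'a) \<Rightarrow> (real \<times> real \<Rightarrow> 'a) \<Rightarrow> real \<times> real \<Rightarrow> 'a"
  where "hcomp_at c g f = (\<lambda>(s, t). if s \<le> c then f (s / c, t) else g ((s - c) / (1 - c), t))"

text \<open>The set \<open>N(\<pp>, \<W>)\<close>, with \<open>\<pp>\<close> given by \<open>a 0 = 0 < a 1 < \<dots> < a (2n+1) = 1\<close> and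
  \<open>\<W>\<close> by \<open>W 1, \<dots>, W (2n+1)\<close>.\<close>

definition path_nbhd :: "'a::topological_space set \<Rightarrow> nat \<Rightarrow> (nat \<Rightarrow> real) \<Rightarrow> (nat \<Rightarrow> 'a set) \<Rightarrow> (real \<Rightarrow> 'a) set"
  where "path_nbhd X n a W = {\<eta>. path \<eta> \<and> path_image \<eta> \<subseteq> X \<and>
    (\<forall>i\<in>{1..2*n+1}. \<eta> ` {a (i - 1)..a i} \<subseteq> W i)}"

text \<open>\<open>V = N(\<pp>, \<W>)\<close> for some \<open>\<pp>\<close> and \<open>\<W>\<close> such that \<open>A\<close> and \<open>B\<close> are the first and the
  last member of \<open>\<W>\<close>.\<close>

definition basic_path_open ::
    "'a::topological_space set \<Rightarrow> (real \<Rightarrow> 'a) set \<Rightarrow> 'a set \<Rightarrow> 'a set \<Rightarrow> bool"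
  where "basic_path_open X V A B \<longleftrightarrow> (\<exists>n a W.
    a 0 = 0 \<and> a (2*n+1) = 1 \<and> (\<forall>i\<le>2*n. a i < a (Suc i)) \<and>
    (\<forall>i\<in>{1..2*n+1}. basic_open X (W i)) \<and>
    (\<forall>i\<in>{1..n}. W (2*i) \<subseteq> W (2*i-1) \<inter> W (2*i+1)) \<and>
    V = path_nbhd X n a W \<and> A = W 1 \<and> B = W (2*n+1))"

text \<open>A 2-track \<open>[h]\<close> is represented here and below by a bigon \<open>h\<close>; the notions depend only on
  the class of \<open>h\<close>.\<close>

definition admissible :: "'a::topological_space set \<Rightarrow> (real \<times> real \<Rightarrow> 'a) \<Rightarrow>
    'a set \<Rightarrow> 'a set \<Rightarrow> (real \<Rightarrow> 'a) set \<Rightarrow> (real \<Rightarrow> 'a) set \<Rightarrow> bool"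
  where "admissible X h U0 U1 V0 V1 \<longleftrightarrow> (\<exists>A0 B0 A1 B1.
    basic_path_open X V0 A0 B0 \<and> src1 h \<in> V0 \<and>
    basic_path_open X V1 A1 B1 \<and> tgt1 h \<in> V1 \<and>
    basic_open X U0 \<and> src0 h \<in> U0 \<and> U0 \<subseteq> A0 \<inter> A1 \<and>
    basic_open X U1 \<and> tgt0 h \<in> U1 \<and> U1 \<subseteq> B0 \<inter> B1)"

text \<open>The set \<open>\<langle>[h], U\<^sub>0, U\<^sub>1, V\<^sub>0, V\<^sub>1\<rangle>\<close> of the 2-tracks
  \<open>[\<lambda>\<^sub>1 + (id\<^bsub>\<beta>\<^sub>1\<^esub> \<bullet> (h \<bullet> id\<^bsub>\<beta>\<^sub>0\<^esub>)) + \<lambda>\<^sub>0]\<close>.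

  The vertical composites force the source and the target path of the whiskered bigon
  \<open>id\<^bsub>\<beta>\<^sub>1\<^esub> \<bullet> (h \<bullet> id\<^bsub>\<beta>\<^sub>0\<^esub>)\<close> to lie in \<open>V\<^sub>0\<close> and \<open>V\<^sub>1\<close>, and these sets depend on the
  parametrization. If both break points are \<open>1/2\<close>, then \<open>\<beta>\<^sub>0\<close>, \<open>h\<close> and \<open>\<beta>\<^sub>1\<close> run on \<open>[0, 1/4]\<close>,
  \<open>[1/4, 1/2]\<close> and \<open>[1/2, 1]\<close>, so that in general the composites do not exist even for constant
  \<open>\<beta>\<^sub>0\<close> and \<open>\<beta>\<^sub>1\<close>, and \<open>[h]\<close> is not in the set. The whiskering is therefore read up to
  reparametrization, with \<open>\<beta>\<^sub>0\<close> and \<open>\<beta>\<^sub>1\<close> run through in a short time at the two ends: the break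
  points are \<open>\<delta>\<close> and \<open>1 - \<delta>\<close>, for every sufficiently small \<open>\<delta> > 0\<close>. The class of the composite
  must be the same 2-track for all these \<open>\<delta>\<close>; allowing a single large \<open>\<delta>\<close> would let the
  reparametrization leave \<open>V\<^sub>0\<close> or \<open>V\<^sub>1\<close> on the way.\<close>

definition track_nbhd :: "'a::topological_space set \<Rightarrow> (real \<times> real \<Rightarrow> 'a) \<Rightarrow>
    'a set \<Rightarrow> 'a set \<Rightarrow> (real \<Rightarrow> 'a) set \<Rightarrow> (real \<Rightarrow> 'a) set \<Rightarrow> (real \<times> real \<Rightarrow> 'a) set set"
  where "track_nbhd X h U0 U1 V0 V1 = {c \<in> two_tracks X. \<exists>\<beta>0 \<beta>1.
    path \<beta>0 \<and> path_image \<beta>0 \<subseteq> U0 \<and> \<beta>0 1 = src0 h \<and>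
    path \<beta>1 \<and> path_image \<beta>1 \<subseteq> U1 \<and> \<beta>1 0 = tgt0 h \<and>
    (\<forall>\<^sub>F \<delta> in at_right 0. \<exists>L0 L1.
      let k = hcomp_at (1 - \<delta>) (id_bigon \<beta>1) (hcomp_at \<delta> h (id_bigon \<beta>0)) in
      bigon X L0 \<and> (\<forall>t\<in>{0..1}. (\<lambda>s. L0 (s, t)) \<in> V0) \<and>
      bigon X L1 \<and> (\<forall>t\<in>{0..1}. (\<lambda>s. L1 (s, t)) \<in> V1) \<and>
      vcomposable k L0 \<and> vcomposable L1 k \<and>
      c = square_class X (vcomp L1 (vcomp k L0)))}"

definition nbhd_basis_at :: "'b topology \<Rightarrow> 'b \<Rightarrow> 'b set set \<Rightarrow> bool"
  where "nbhd_basis_at T x \<B> \<longleftrightarrow>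
    (\<forall>B\<in>\<B>. \<exists>G. openin T G \<and> x \<in> G \<and> G \<subseteq> B) \<and>
    (\<forall>G. openin T G \<and> x \<in> G \<longrightarrow> (\<exists>B\<in>\<B>. B \<subseteq> G))"

end

theory Submission
  imports Defs
begin

text \<open>A 2-track \<open>[f]\<close> in \<open>\<langle>[h], U0, U1, V0, V1\<rangle>\<close> has \<open>(U0, U1, V0, V1)\<close> as an admissible quadruple, and
  \<open>\<langle>[f], U0, U1, V0, V1\<rangle> \<subseteq> \<langle>[h], U0, U1, V0, V1\<rangle>\<close>: substitute \<open>f = \<lambda>1 + (h whiskered by \<beta>0, \<beta>1) + \<lambda>0\<close> into
  \<open>\<lambda>1' + (f whiskered by \<gamma>0, \<gamma>1) + \<lambda>0'\<close>, distribute the outer whiskering over the sum and join the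
  paths. The whiskered \<open>\<lambda>0\<close> and \<open>\<lambda>1\<close> and the homotopies that adjust the parametrization stay in \<open>V0\<close> and
  \<open>V1\<close> by compactness, because all break points may be taken close to \<open>0\<close> and \<open>1\<close>. Hence each of the sets is
  a neighbourhood of all its points. That finitely many of them contain a common smaller one
  follows from a Lebesgue number argument, which produces basic open sets of paths.\<close>

section \<open>Classes of bigons\<close>

text \<open>The obstacle is that \<open>V0\<close> and \<open>V1\<close> restrict paths at fixed
  times, so they are not invariant under reparametrization, while the laws of horizontal composition
  hold only up to reparametrization. Three unrelated break parameters meet: that of the
  decomposition of \<open>f\<close>, that of the outer whiskering, and the one prescribed for the
  decomposition sought. To compare them, every whiskering is written as a map \<open>extend\<close>
  on [-1,2] x [0,1], precomposed with a function of s alone. Changing the break parameter is then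
  linear interpolation between two such functions. The bottom and top edges move during it, so it is
  not a homotopy relative to the boundary; the surfaces that they sweep out are absorbed into the
  lower and upper flanking bigons. These surfaces stay in \<open>V0\<close> and \<open>V1\<close>
  because of \<open>near_param\<close>, a condition convex in the parameter, which holds with
  \<epsilon> = 8 \<delta> for one whiskering and with the sum of two such bounds for an iterated
  one.\<close>

lemma mem_square_boundary:
  "(s, t) \<in> square_boundary \<longleftrightarrow> s \<in> {0..1} \<and> t \<in> {0..1} \<and> (s \<in> {0,1} \<or> t \<in> {0,1})"
  by (auto simp: square_boundary_def)

lemma square_boundaryD: "z \<in> square_boundary \<Longrightarrow> z \<in> unit_square"
  by (auto simp: square_boundary_def)

lemma square_class_iff:
  "g \<in> square_class X f \<longleftrightarrow>
    (\<exists>H. continuous_on ({0..1::real} \<times> unit_square) H \<and> H ` ({0..1::real} \<times> unit_square) \<subseteq> X \<and>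
      (\<forall>z\<in>unit_square. H (0, z) = f z \<and> H (1, z) = g z) \<and>
      (\<forall>r\<in>{0..1}. \<forall>z\<in>square_boundary. H (r, z) = f z))"
proof -
  \<comment> \<open>\<open>homotopic_with\<close> unfolds to a homotopy on the square only for
    properties that do not distinguish maps equal there. The boundary condition is such a property
    because the boundary lies in the square.\<close>
  have P: "(\<forall>z\<in>square_boundary. h z = f z) \<longleftrightarrow> (\<forall>z\<in>square_boundary. k z = f z)"
    if "\<And>x. x \<in> topspace (top_of_set unit_square) \<Longrightarrow> h x = k x" for h k
    using that square_boundaryD by fastforce
  show ?thesis
    unfolding square_class_def mem_Collect_eq
    by (subst homotopic_with[OF P]) (simp_all add: image_subset_iff_funcset[symmetric] ball_conj_distrib conj_assoc)
qed

lemma square_class_self: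
  "continuous_on unit_square f \<Longrightarrow> f ` unit_square \<subseteq> X \<Longrightarrow> f \<in> square_class X f"
  by (auto simp: square_class_def image_subset_iff_funcset)

text \<open>The boundary condition in a class refers to its representative. Replacing
  \<open>f\<close> by \<open>g\<close> does not change it, since \<open>g\<close> has the boundary
  values of \<open>f\<close>; the rest is symmetry and transitivity of homotopy.\<close>

lemma square_class_eq:
  assumes "g \<in> square_class X f"
  shows "square_class X g = square_class X f"
proof -
  let ?P = "\<lambda>k. \<forall>z\<in>square_boundary. k z = f z"
  have hom: "homotopic_with_canon ?P unit_square X f g"
    using assms by (simp add: square_class_def)
  then have "?P g"
    by (rule homotopic_with_imp_property[THEN conjunct2])
  then have "square_class X g = {k. homotopic_with_canon ?P unit_square X g k}"
    by (simp add: square_class_def)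
  then show ?thesis
    using hom homotopic_with_symD[OF hom] unfolding square_class_def
    by (blast intro: homotopic_with_trans)
qed

text \<open>\<open>square_class\<close> is empty for maps that are not continuous on the square or
  leave \<open>X\<close>, so equal classes alone would identify all of these. Requiring bigons on
  both sides gives a relation suited to calculational chains.\<close>

definition same_track ::
    "'a::topological_space set \<Rightarrow> (real \<times> real \<Rightarrow> 'a) \<Rightarrow> (real \<times> real \<Rightarrow> 'a) \<Rightarrow> bool"
  where "same_track X f g \<longleftrightarrow> bigon X f \<and> bigon X g \<and> square_class X f = square_class X g"

lemma same_track_refl: "bigon X f \<Longrightarrow> same_track X f f"
  by (simp add: same_track_def)

lemma same_track_sym: "same_track X f g \<Longrightarrow> same_track X g f"
  by (simp add: same_track_def)

lemma same_track_trans [trans]: "same_track X f g \<Longrightarrow> same_track X g h \<Longrightarrow> same_track X f h"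
  by (simp add: same_track_def)

lemma bigonD:
  assumes "bigon X f"
  shows "continuous_on unit_square f" "f ` unit_square \<subseteq> X"
    "t \<in> {0..1} \<Longrightarrow> f (0, t) = src0 f" "t \<in> {0..1} \<Longrightarrow> f (1, t) = tgt0 f"
proof -
  obtain x y where "\<forall>z\<in>{0} \<times> {0..1}. f z = x" "\<forall>z\<in>{1} \<times> {0..1}. f z = y"
    using assms unfolding bigon_def constant_on_def by blast
  then show "t \<in> {0..1} \<Longrightarrow> f (0, t) = src0 f" "t \<in> {0..1} \<Longrightarrow> f (1, t) = tgt0 f"
    by (simp_all add: src0_def tgt0_def)
qed (use assms in \<open>simp_all add: bigon_def\<close>)

lemma bigonI:
  assumes "continuous_on unit_square f" "\<And>s t. s \<in> {0..1} \<Longrightarrow> t \<in> {0..1} \<Longrightarrow> f (s, t) \<in> X"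
    "\<And>t. t \<in> {0..1} \<Longrightarrow> f (0, t) = x" "\<And>t. t \<in> {0..1} \<Longrightarrow> f (1, t) = y"
  shows "bigon X f"
proof -
  have "\<forall>z\<in>{0} \<times> {0..1}. f z = x" "\<forall>z\<in>{1} \<times> {0..1}. f z = y" "\<forall>z\<in>unit_square. f z \<in> X"
    using assms by simp_all
  then show ?thesis
    using assms(1) unfolding bigon_def constant_on_def by blast
qed

lemma bigon_cong:
  assumes "\<And>z. z \<in> unit_square \<Longrightarrow> f z = g z"
  shows "bigon X f \<longleftrightarrow> bigon X g"
proof -
  have const: "f constant_on S \<longleftrightarrow> g constant_on S" if "S \<subseteq> unit_square" for S
    using assms that unfolding constant_on_def by (metis subsetD)
  have "continuous_on unit_square f \<longleftrightarrow> continuous_on unit_square g"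
    using assms by (intro continuous_on_cong) auto
  moreover have "f ` unit_square = g ` unit_square"
    using assms by (intro image_cong) auto
  moreover have "f constant_on {0} \<times> {0..1} \<longleftrightarrow> g constant_on {0} \<times> {0..1}"
    "f constant_on {1} \<times> {0..1} \<longleftrightarrow> g constant_on {1} \<times> {0..1}"
    by (rule const; simp add: Sigma_mono)+
  ultimately show ?thesis
    unfolding bigon_def by simp
qed

lemma same_track_iff:
  "same_track X f g \<longleftrightarrow> bigon X f \<and> bigon X g \<and> g \<in> square_class X f"
  using square_class_eq[of g X f] square_class_self[OF bigonD(1,2)] by (auto simp: same_track_def)

lemma same_track_boundary:
  assumes "same_track X f g" "z \<in> square_boundary"
  shows "g z = f z"
  using assms unfolding same_track_iff square_class_def mem_Collect_eq
  using homotopic_with_imp_property by blast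

lemma same_track_cong:
  assumes f: "bigon X f" and eq: "\<And>z. z \<in> unit_square \<Longrightarrow> f z = g z"
  shows "same_track X f g"
  unfolding same_track_iff square_class_iff
proof (intro conjI exI[of _ "\<lambda>(r::real, z). f z"])
  show "bigon X g"
    using bigon_cong eq f by blast
  have "continuous_on ({0..1::real} \<times> unit_square) (\<lambda>p. f (snd p))"
    by (rule continuous_on_compose2[OF bigonD(1)[OF f]]) (auto intro!: continuous_intros)
  then show "continuous_on ({0..1::real} \<times> unit_square) (\<lambda>(r, z). f z)"
    by (simp add: split_def)
qed (use f eq bigonD(2)[OF f] in auto)

text \<open>The associativity law and all reparametrizations are straight-line homotopies inside a convex domain
  of a single map \<open>K\<close>.\<close>

lemma same_track_convex:
  fixes K :: "'b::real_normed_vector \<Rightarrow> 'a::topological_space"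
  assumes K: "continuous_on D K" "K ` D \<subseteq> X" and D: "convex D"
    and phi: "continuous_on unit_square \<phi>" "\<phi> ` unit_square \<subseteq> D"
    and psi: "continuous_on unit_square \<psi>" "\<psi> ` unit_square \<subseteq> D"
    and bd: "\<And>r z. r \<in> {0..1} \<Longrightarrow> z \<in> square_boundary \<Longrightarrow>
      K ((1 - r) *\<^sub>R \<phi> z + r *\<^sub>R \<psi> z) = K (\<phi> z)"
    and f: "bigon X f" "\<And>z. z \<in> unit_square \<Longrightarrow> f z = K (\<phi> z)"
    and g: "bigon X g" "\<And>z. z \<in> unit_square \<Longrightarrow> g z = K (\<psi> z)"
  shows "same_track X f g"
  unfolding same_track_iff square_class_iff
proof (intro conjI exI[of _ "\<lambda>p. K ((1 - fst p) *\<^sub>R \<phi> (snd p) + fst p *\<^sub>R \<psi> (snd p))"] f(1) g(1))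
  let ?H = "\<lambda>p. K ((1 - fst p) *\<^sub>R \<phi> (snd p) + fst p *\<^sub>R \<psi> (snd p))"
  have inD: "(1 - fst p) *\<^sub>R \<phi> (snd p) + fst p *\<^sub>R \<psi> (snd p) \<in> D" if "p \<in> {0..1::real} \<times> unit_square" for p
    using that phi(2) psi(2) by (intro convexD[OF D]) (auto simp: image_subset_iff)
  show "continuous_on ({0..1::real} \<times> unit_square) ?H"
    by (rule continuous_on_compose2[OF K(1)])
      (auto intro!: continuous_intros continuous_on_compose2[OF phi(1)] continuous_on_compose2[OF psi(1)] inD)
  show "?H ` ({0..1::real} \<times> unit_square) \<subseteq> X"
    using K(2) inD by blast
  show "\<forall>z\<in>unit_square. ?H (0, z) = f z \<and> ?H (1, z) = g z"
    using f(2) g(2) by auto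
  show "\<forall>r\<in>{0..1}. \<forall>z\<in>square_boundary. ?H (r, z) = f z"
    using bd f(2) square_boundaryD by auto
qed

section \<open>Vertical composition of bigons and 2-tracks\<close>

lemma src1_vcomp [simp]: "src1 (vcomp g f) = src1 f"
  and tgt1_vcomp [simp]: "tgt1 (vcomp g f) = tgt1 g"
  by (auto simp: src1_def tgt1_def vcomp_def)

lemma vcomposable_vcomp [simp]:
  "vcomposable (vcomp h g) f \<longleftrightarrow> vcomposable g f"
  "vcomposable h (vcomp g f) \<longleftrightarrow> vcomposable h g"
  by (simp_all add: vcomposable_def)

lemma vcomp_continuous:
  assumes "continuous_on unit_square f" "continuous_on unit_square g" "vcomposable g f"
  shows "continuous_on unit_square (vcomp g f)"
proof -
  have glue: "f (fst z, 2 * snd z) = g (fst z, 2 * snd z - 1)" if "z \<in> unit_square" "snd z = 1/2" for z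
  proof -
    have half: "2 * snd z = 1"
      using that by simp
    show ?thesis
      unfolding half using that assms(3) by (auto simp: vcomposable_def src1_def tgt1_def)
  qed
  have "continuous_on unit_square (\<lambda>z. if snd z \<le> 1/2 then f (fst z, 2 * snd z) else g (fst z, 2 * snd z - 1))"
    by (intro continuous_on_cases_le continuous_on_compose2[OF assms(1)] continuous_on_compose2[OF assms(2)])
      (rule glue; assumption | intro continuous_intros | force)+
  then show ?thesis
    by (simp add: vcomp_def split_def)
qed

lemma vcomp_bigon:
  assumes f: "bigon X f" and g: "bigon X g" and "vcomposable g f"
  shows "bigon X (vcomp g f)"
proof (rule bigonI)
  show "continuous_on unit_square (vcomp g f)"
    using assms bigonD(1) by (intro vcomp_continuous) auto
  have fg: "f (0, 1) = g (0, 0)" "f (1, 1) = g (1, 0)"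
    using assms(3) by (auto simp: vcomposable_def src1_def tgt1_def)
  show "vcomp g f (0, t) = src0 f" "vcomp g f (1, t) = tgt0 f" if "t \<in> {0..1}" for t
    using that fg bigonD(3,4)[OF f, of 1] bigonD(3,4)[OF f, of "2*t"] bigonD(3,4)[OF g, of "2*t-1"]
    by (auto simp: vcomp_def src0_def tgt0_def)
  show "vcomp g f (s, t) \<in> X" if "s \<in> {0..1}" "t \<in> {0..1}" for s t
    using that bigonD(2)[OF f] bigonD(2)[OF g] by (auto simp: vcomp_def image_subset_iff)
qed

text \<open>The two homotopies are stacked. They agree along the common edge t = 1/2 because
  homotopies relative to the boundary are stationary on horizontal edges.\<close>

lemma vcomp_same_track:
  assumes f: "same_track X f f'" and g: "same_track X g g'" and fg: "vcomposable g f"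
  shows "vcomposable g' f'" "same_track X (vcomp g f) (vcomp g' f')"
proof -
  show fg': "vcomposable g' f'"
    using fg same_track_boundary[OF f] same_track_boundary[OF g]
    by (auto simp: vcomposable_def src1_def tgt1_def square_boundary_def)
  have big: "bigon X f" "bigon X g" "bigon X f'" "bigon X g'"
    using f g by (auto simp: same_track_def)
  obtain H where H: "continuous_on ({0..1::real} \<times> unit_square) H" "H ` ({0..1::real} \<times> unit_square) \<subseteq> X"
      "\<forall>z\<in>unit_square. H (0, z) = f z \<and> H (1, z) = f' z" "\<forall>r\<in>{0..1}. \<forall>z\<in>square_boundary. H (r, z) = f z"
    using f unfolding same_track_iff square_class_iff by blast
  obtain K where K: "continuous_on ({0..1::real} \<times> unit_square) K" "K ` ({0..1::real} \<times> unit_square) \<subseteq> X"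
      "\<forall>z\<in>unit_square. K (0, z) = g z \<and> K (1, z) = g' z" "\<forall>r\<in>{0..1}. \<forall>z\<in>square_boundary. K (r, z) = g z"
    using g unfolding same_track_iff square_class_iff by blast
  let ?G = "\<lambda>p. if snd (snd p) \<le> 1/2 then H (fst p, fst (snd p), 2 * snd (snd p))
    else K (fst p, fst (snd p), 2 * snd (snd p) - 1)"
  have glue: "H (fst p, fst (snd p), 2 * snd (snd p)) = K (fst p, fst (snd p), 2 * snd (snd p) - 1)"
    if "p \<in> {0..1::real} \<times> unit_square" "snd (snd p) = 1/2" for p
  proof -
    have half: "2 * snd (snd p) = 1"
      using that by simp
    show ?thesis
      unfolding half using that fg H(4) K(4)
      by (auto simp: vcomposable_def src1_def tgt1_def square_boundary_def)
  qed
  have "vcomp g' f' \<in> square_class X (vcomp g f)"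
    unfolding square_class_iff
  proof (intro conjI exI[of _ ?G])
    show "continuous_on ({0..1::real} \<times> unit_square) ?G"
      by (intro continuous_on_cases_le continuous_on_compose2[OF H(1)] continuous_on_compose2[OF K(1)])
        (rule glue; assumption | intro continuous_intros | force)+
    show "?G ` ({0..1::real} \<times> unit_square) \<subseteq> X"
      using H(2) K(2) by (auto simp: image_subset_iff)
    show "\<forall>z\<in>unit_square. ?G (0, z) = vcomp g f z \<and> ?G (1, z) = vcomp g' f' z"
      using H(3) K(3) by (auto simp: vcomp_def)
    show "\<forall>r\<in>{0..1}. \<forall>z\<in>square_boundary. ?G (r, z) = vcomp g f z"
    proof (intro ballI)
      fix r :: real and z assume r: "r \<in> {0..1}" and "z \<in> square_boundary"
      then obtain s t where z: "z = (s, t)" "(s, t) \<in> square_boundary"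
        by (cases z) auto
      have "(s, 2 * t) \<in> square_boundary" if "t \<le> 1/2"
        using z(2) that by (auto simp: mem_square_boundary)
      moreover have "(s, 2 * t - 1) \<in> square_boundary" if "1/2 < t"
        using z(2) that by (auto simp: mem_square_boundary)
      ultimately show "?G (r, z) = vcomp g f z"
        using r H(4) K(4) by (simp add: z(1) vcomp_def)
    qed
  qed
  then show "same_track X (vcomp g f) (vcomp g' f')"
    unfolding same_track_iff using vcomp_bigon big fg fg' by blast
qed

lemma vcomp_assoc:
  assumes f: "bigon X f" and g: "bigon X g" and h: "bigon X h"
    and gf: "vcomposable g f" and hg: "vcomposable h g"
  shows "same_track X (vcomp (vcomp h g) f) (vcomp h (vcomp g f))"
proof -
  \<comment> \<open>The left-nested composite changes bigon at heights 1/2 and 3/4, the right-nested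
    one at 1/4 and 1/2; \<tau> maps the first pair of heights affinely to the second.\<close>
  define \<tau> :: "real \<Rightarrow> real" where
    "\<tau> t = (if t \<le> 1/2 then t / 2 else if t \<le> 3/4 then t - 1/4 else 2 * t - 1)" for t
  let ?M = "vcomp h (vcomp g f)"
  have M: "bigon X ?M" and L: "bigon X (vcomp (vcomp h g) f)"
    using assms by (auto intro!: vcomp_bigon)
  have eq: "vcomp (vcomp h g) f (s, t) = ?M (s, \<tau> t)" if "s \<in> {0..1}" "t \<in> {0..1}" for s t
    by (auto simp: vcomp_def \<tau>_def algebra_simps)
  have "continuous_on UNIV \<tau>"
    unfolding \<tau>_def by (intro continuous_on_cases_le continuous_intros) auto
  then have cont: "continuous_on S \<tau>" for S
    by (rule continuous_on_subset) auto
  have tau: "\<tau> t \<in> {0..1}" if "t \<in> {0..1}" for t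
    using that by (auto simp: \<tau>_def)
  have mix: "(1 - r) * \<tau> t + r * t \<in> {0..1}" if "r \<in> {0..1}" "t \<in> {0..1}" for r t
    using convexD_alt[of "{0..1::real}" "\<tau> t" t r] that tau by auto
  have tau01: "\<tau> 0 = 0" "\<tau> 1 = 1"
    by (auto simp: \<tau>_def)
  show ?thesis
  proof (rule same_track_convex[OF bigonD(1,2)[OF M], where \<phi> = "\<lambda>z. (fst z, \<tau> (snd z))" and \<psi> = "\<lambda>z. z"])
    show "continuous_on unit_square (\<lambda>z. (fst z, \<tau> (snd z)))"
      by (intro continuous_intros continuous_on_compose2[OF cont]) auto
    show "(\<lambda>z. (fst z, \<tau> (snd z))) ` unit_square \<subseteq> unit_square"
      using tau by force
    show "convex (unit_square)"
      by (intro convex_Times convex_real_interval)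
    show "vcomp (vcomp h g) f z = ?M (fst z, \<tau> (snd z))" if "z \<in> unit_square" for z
      using eq that by (cases z) simp
    show "?M ((1 - r) *\<^sub>R (fst z, \<tau> (snd z)) + r *\<^sub>R z) = ?M (fst z, \<tau> (snd z))"
      if r: "r \<in> {0..1}" and zb: "z \<in> square_boundary" for r z
    proof -
      obtain s t where z: "z = (s, t)"
        by (cases z)
      have st: "s \<in> {0..1}" "t \<in> {0..1}" "s \<in> {0,1} \<or> t \<in> {0,1}"
        using zb by (simp_all add: z mem_square_boundary)
      \<comment> \<open>On the vertical sides the composite is constant in t, and on the horizontal
        edges t is a fixed point of \<tau>.\<close>
      have "?M (s, (1 - r) * \<tau> t + r * t) = ?M (s, \<tau> t)"
      proof (cases "s \<in> {0,1}")
        case True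
        then show ?thesis
          using bigonD(3,4)[OF M mix[OF r st(2)]] bigonD(3,4)[OF M tau[OF st(2)]] by auto
      next
        case False
        then show ?thesis
          using st tau01 by auto
      qed
      then show ?thesis
        by (simp add: z algebra_simps)
    qed
  qed (simp_all add: M L)
qed

section \<open>Open sets of paths\<close>

text \<open>\<open>N(\<pp>, \<W>)\<close> consists of the paths with \<open>\<eta> s \<in> R s\<close> for all \<open>s\<close>, where \<open>R s\<close> is the intersection of the
  \<open>W i\<close> with \<open>s \<in> [a (i-1), a i]\<close>. Only the following semicontinuity of \<open>R\<close> matters.\<close>

definition path_control :: "'a::topological_space set \<Rightarrow> (real \<Rightarrow> 'a set) \<Rightarrow> bool"
  where "path_control X R \<longleftrightarrow> (\<forall>s\<in>{0..1}. openin (top_of_set X) (R s) \<and>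
    (\<exists>d>0. \<forall>s'\<in>{0..1}. \<bar>s' - s\<bar> < d \<longrightarrow> R s \<subseteq> R s'))"

definition controlled_paths :: "'a::topological_space set \<Rightarrow> (real \<Rightarrow> 'a set) \<Rightarrow> (real \<Rightarrow> 'a) set"
  where "controlled_paths X R = {\<eta>. path \<eta> \<and> path_image \<eta> \<subseteq> X \<and> (\<forall>s\<in>{0..1}. \<eta> s \<in> R s)}"

lemma path_control_const: "path_control X (\<lambda>s. X)"
  by (auto simp: path_control_def intro: exI[of _ 1])

lemma path_control_Int:
  assumes "path_control X R" "path_control X R'"
  shows "path_control X (\<lambda>s. R s \<inter> R' s)"
  unfolding path_control_def
proof (intro ballI conjI)
  fix s :: real assume s: "s \<in> {0..1}"
  show "openin (top_of_set X) (R s \<inter> R' s)"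
    using assms s by (simp add: path_control_def openin_Int)
  obtain d d' where "d > 0" "\<forall>s'\<in>{0..1}. \<bar>s' - s\<bar> < d \<longrightarrow> R s \<subseteq> R s'"
    "d' > 0" "\<forall>s'\<in>{0..1}. \<bar>s' - s\<bar> < d' \<longrightarrow> R' s \<subseteq> R' s'"
    using assms s unfolding path_control_def by meson
  then show "\<exists>d>0. \<forall>s'\<in>{0..1}. \<bar>s' - s\<bar> < d \<longrightarrow> R s \<inter> R' s \<subseteq> R s' \<inter> R' s'"
    by (intro exI[of _ "min d d'"]) auto
qed

lemma controlled_paths_Int:
  "controlled_paths X (\<lambda>s. R s \<inter> R' s) = controlled_paths X R \<inter> controlled_paths X R'"
  by (auto simp: controlled_paths_def)

lemma basic_open_subset: "basic_open X U \<Longrightarrow> U \<subseteq> X"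
  using openin_imp_subset by (auto simp: basic_open_def)

text \<open>Semicontinuity comes from the closedness of the partition intervals: those that miss s
  have a closed union, so a time close to s lies in no interval other than those containing s, and
  fewer sets are intersected there. At 0 and 1 only the first and the last interval remain, as the
  partition is strictly increasing.\<close>

lemma basic_path_open_controlled:
  assumes "basic_path_open X V A B"
  obtains R where "path_control X R" "V = controlled_paths X R" "R 0 = A" "R 1 = B"
proof -
  obtain n a W where a0: "a 0 = 0" and a1: "a (2*n+1) = (1::real)" and inc: "\<And>i. i \<le> 2*n \<Longrightarrow> a i < a (Suc i)"
    and W: "\<And>i. i \<in> {1..2*n+1} \<Longrightarrow> basic_open X (W i)"
    and V: "V = path_nbhd X n a W" and A: "A = W 1" and B: "B = W (2*n+1)"
    using assms unfolding basic_path_open_def by blast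
  let ?I = "\<lambda>s. {i \<in> {1..2*n+1}. s \<in> {a (i-1)..a i}}"
  \<comment> \<open>The factor \<open>X\<close> gives the intersection the form delivered by
    \<open>openin_INT\<close>, whether or not the index set is empty.\<close>
  define R where "R s = (\<Inter>i\<in>?I s. W i) \<inter> X" for s
  have mono: "a i \<le> a j" if "i \<le> j" "j \<le> 2*n+1" for i j
    using that
  proof (induction rule: dec_induct)
    case (step j)
    then show ?case
      using inc[of j] by simp
  qed simp
  have sub: "{a (i-1)..a i} \<subseteq> {0..1}" if "i \<in> {1..2*n+1}" for i
    using that mono[of 0 "i-1"] mono[of i "2*n+1"] a0 a1 by auto
  have "path_control X R"
    unfolding path_control_def
  proof (intro ballI conjI)
    fix s :: real assume "s \<in> {0..1}"
    show "openin (top_of_set X) (R s)"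
    proof -
      have "openin (top_of_set X) ((\<Inter>i\<in>?I s. W i) \<inter> topspace (top_of_set X))"
      proof (rule openin_INT)
        show "openin (top_of_set X) (W i)" if "i \<in> ?I s" for i
          using W[of i] that unfolding basic_open_def by blast
      qed simp
      then show ?thesis
        by (simp add: R_def)
    qed
    let ?K = "\<Union>i\<in>{1..2*n+1} - ?I s. {a (i-1)..a i}"
    have "open (- ?K)"
      by (intro open_Compl closed_UN) auto
    moreover have "s \<in> - ?K"
      by auto
    ultimately obtain d where d: "d > 0" "ball s d \<subseteq> - ?K"
      using open_contains_ball by blast
    have "?I s' \<subseteq> ?I s" if "\<bar>s' - s\<bar> < d" for s'
    proof -
      have "s' \<in> ball s d"
        using that by (simp add: dist_real_def abs_minus_commute)
      then have "s' \<notin> ?K"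
        using d(2) by blast
      then show ?thesis
        by blast
    qed
    then show "\<exists>d>0. \<forall>s'\<in>{0..1}. \<bar>s' - s\<bar> < d \<longrightarrow> R s \<subseteq> R s'"
      using d(1) unfolding R_def by (intro exI[of _ d]) blast
  qed
  moreover have "V = controlled_paths X R"
  proof -
    have "(\<forall>i\<in>{1..2*n+1}. \<eta> ` {a (i-1)..a i} \<subseteq> W i) \<longleftrightarrow> (\<forall>s\<in>{0..1}. \<eta> s \<in> R s)"
      if X: "path_image \<eta> \<subseteq> X" for \<eta>
    proof
      assume l: "\<forall>i\<in>{1..2*n+1}. \<eta> ` {a (i-1)..a i} \<subseteq> W i"
      show "\<forall>s\<in>{0..1}. \<eta> s \<in> R s"
        using l X unfolding R_def path_image_def by blast
    next
      assume r: "\<forall>s\<in>{0..1}. \<eta> s \<in> R s"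
      show "\<forall>i\<in>{1..2*n+1}. \<eta> ` {a (i-1)..a i} \<subseteq> W i"
      proof (intro ballI image_subsetI)
        fix i s assume i: "i \<in> {1..2*n+1}" and s: "s \<in> {a (i-1)..a i}"
        then have "\<eta> s \<in> R s"
          using sub[OF i] r by blast
        then show "\<eta> s \<in> W i"
          using i s unfolding R_def by blast
      qed
    qed
    then show ?thesis
      unfolding V path_nbhd_def controlled_paths_def by blast
  qed
  moreover have "R 0 = A"
  proof -
    have "i = 1" if "i \<in> ?I 0" for i
    proof (rule ccontr)
      assume "i \<noteq> 1"
      then have "a 1 \<le> a (i-1)"
        using that by (intro mono) auto
      then show False
        using that inc[of 0] a0 by simp
    qed
    moreover have "1 \<in> ?I 0"
      using inc[of 0] a0 by simp
    ultimately have "?I 0 = {1}"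
      by blast
    then show ?thesis
      using basic_open_subset[OF W[of 1]] by (auto simp: R_def A)
  qed
  moreover have "R 1 = B"
  proof -
    have "i = 2*n+1" if "i \<in> ?I 1" for i
    proof (rule ccontr)
      assume "i \<noteq> 2*n+1"
      then have "a i \<le> a (2*n)"
        using that by (intro mono) auto
      then show False
        using that inc[of "2*n"] a1 by simp
    qed
    moreover have "2*n+1 \<in> ?I 1"
      using inc[of "2*n"] a1 by simp
    ultimately have "?I 1 = {2*n+1}"
      by blast
    then show ?thesis
      using basic_open_subset[OF W[of "2*n+1"]] by (auto simp: R_def B)
  qed
  ultimately show ?thesis
    by (rule that)
qed

lemma ex_interval_of_partition:
  fixes a :: "nat \<Rightarrow> real"
  assumes "a 0 \<le> s" "s \<le> a m" "1 \<le> m"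
  shows "\<exists>i\<in>{1..m}. s \<in> {a (i-1)..a i}"
  using assms(2,3)
proof (induction m)
  case (Suc m)
  show ?case
  proof (cases "1 \<le> m \<and> s \<le> a m")
    case True
    then show ?thesis
      using Suc.IH by fastforce
  next
    case False
    then have "a m \<le> s"
      using assms(1) by (cases m) auto
    then show ?thesis
      using Suc.prems by (intro bexI[of _ "Suc m"]) auto
  qed
qed simp

lemma path_preimage_ball:
  assumes "path \<gamma>" "path_image \<gamma> \<subseteq> X" "openin (top_of_set X) U" "s \<in> {0..1}" "\<gamma> s \<in> U"
  obtains d where "d > 0" "\<And>s'. s' \<in> {0..1} \<Longrightarrow> \<bar>s' - s\<bar> < d \<Longrightarrow> \<gamma> s' \<in> U"
proof -
  have "openin (top_of_set {0..1}) ({0..1} \<inter> \<gamma> -` U)"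
    using assms(1,2,3) unfolding path_def path_image_def
    by (intro continuous_openin_preimage[of _ _ X]) (auto simp: image_subset_iff_funcset)
  moreover have "s \<in> {0..1} \<inter> \<gamma> -` U"
    using assms by simp
  ultimately obtain d where d: "d > 0" "ball s d \<inter> {0..1} \<subseteq> {0..1} \<inter> \<gamma> -` U"
    unfolding openin_contains_ball by blast
  show ?thesis
  proof (rule that[OF d(1)])
    fix s' :: real assume "s' \<in> {0..1}" "\<bar>s' - s\<bar> < d"
    then have "s' \<in> ball s d \<inter> {0..1}"
      by (simp add: dist_real_def abs_minus_commute)
    then show "\<gamma> s' \<in> U"
      using d(2) by blast
  qed
qed

text \<open>A fine equidistant partition gives the odd members of the chain; the even ones are small basic
  open sets around the images of the partition points.\<close>

lemma controlled_paths_basic: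
  assumes X: "semilocally_2_connected X" and R: "path_control X R" and \<gamma>: "\<gamma> \<in> controlled_paths X R"
  obtains V A B where "basic_path_open X V A B" "\<gamma> \<in> V" "V \<subseteq> controlled_paths X R"
proof -
  have path: "path \<gamma>" "path_image \<gamma> \<subseteq> X" and \<gamma>R: "\<And>s. s \<in> {0..1} \<Longrightarrow> \<gamma> s \<in> R s"
    using \<gamma> by (auto simp: controlled_paths_def)
  have basic: "\<exists>U. basic_open X U \<and> \<gamma> s \<in> U \<and> U \<subseteq> G"
    if "openin (top_of_set X) G" "\<gamma> s \<in> G" for s G
    using X that openin_imp_subset[OF that(1)] unfolding semilocally_2_connected_def by blast
  \<comment> \<open>One radius meets two demands: the path stays in U, and every set allowed at time
    s remains allowed nearby. Together they make U a legitimate constraint on the whole interval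
    around s.\<close>
  have "\<exists>U d. basic_open X U \<and> U \<subseteq> R s \<and> d > 0 \<and>
      (\<forall>s'\<in>{0..1}. \<bar>s' - s\<bar> < d \<longrightarrow> R s \<subseteq> R s' \<and> \<gamma> s' \<in> U)" if s: "s \<in> {0..1}" for s
  proof -
    obtain d1 where d1: "d1 > 0" "\<forall>s'\<in>{0..1}. \<bar>s' - s\<bar> < d1 \<longrightarrow> R s \<subseteq> R s'"
      and op: "openin (top_of_set X) (R s)"
      using R s unfolding path_control_def by blast
    obtain U where U: "basic_open X U" "\<gamma> s \<in> U" "U \<subseteq> R s"
      using basic[OF op \<gamma>R[OF s]] by blast
    then have "openin (top_of_set X) U"
      by (simp add: basic_open_def)
    then obtain d2 where d2: "d2 > 0" "\<And>s'. s' \<in> {0..1} \<Longrightarrow> \<bar>s' - s\<bar> < d2 \<Longrightarrow> \<gamma> s' \<in> U"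
      using path_preimage_ball[OF path _ s U(2)] by blast
    show ?thesis
      using U d1 d2 by (intro exI[of _ U] exI[of _ "min d1 d2"]) auto
  qed
  then obtain U d where U: "\<And>s. s \<in> {0..1} \<Longrightarrow> basic_open X (U s)" "\<And>s. s \<in> {0..1} \<Longrightarrow> U s \<subseteq> R s"
    and d: "\<And>s. s \<in> {0..1} \<Longrightarrow> d s > 0"
    and near: "\<And>s s'. s \<in> {0..1} \<Longrightarrow> s' \<in> {0..1} \<Longrightarrow> \<bar>s' - s\<bar> < d s \<Longrightarrow> R s \<subseteq> R s' \<and> \<gamma> s' \<in> U s"
    by metis
  have cover: "{0..1} \<subseteq> \<Union>((\<lambda>s. ball s (d s)) ` {0..1})"
    using d by force
  obtain e where e: "e > 0" "\<And>s. s \<in> {0..1} \<Longrightarrow> \<exists>G\<in>(\<lambda>s. ball s (d s)) ` {0..1}. ball s e \<subseteq> G"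
    using Heine_Borel_lemma[OF compact_Icc cover] by blast
  obtain N :: nat where N: "N > 0" "inverse (real N) < e"
    using ex_inverse_of_nat_less[OF e(1)] by blast
  then obtain n where n: "N = Suc n"
    using gr0_implies_Suc by blast
  have "\<exists>p\<in>{0..1}. ball (real j / N) e \<subseteq> ball p (d p)" if "j \<le> N" for j
    using e(2)[of "real j / N"] that N(1) by (auto simp: divide_simps)
  then obtain p where p: "\<And>j. j \<le> N \<Longrightarrow> p j \<in> {0..1}"
      "\<And>j. j \<le> N \<Longrightarrow> ball (real j / N) e \<subseteq> ball (p j) (d (p j))"
    by metis
  \<comment> \<open>The segment [(j-1)/N, j/N] is indexed by its right endpoint. Its points are at
    distance at most 1/N < e from j/N, hence within the radius belonging to
    \<open>p j\<close>.\<close>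
  have seg: "\<gamma> s \<in> U (p j)" "U (p j) \<subseteq> R s"
    if "j \<le> N" "s \<in> {0..1}" "(real j - 1) / N \<le> s" "s \<le> real j / N" for j s
  proof -
    have "\<bar>s - real j / N\<bar> < e"
      using that(3,4) N by (simp add: diff_divide_distrib inverse_eq_divide)
    then have "s \<in> ball (real j / N) e"
      by (simp add: dist_real_def abs_minus_commute)
    then have "\<bar>s - p j\<bar> < d (p j)"
      using p(2)[OF that(1)] by (auto simp: dist_real_def abs_minus_commute)
    then show "\<gamma> s \<in> U (p j)" "U (p j) \<subseteq> R s"
      using near[OF p(1)[OF that(1)] that(2)] U(2)[OF p(1)[OF that(1)]] by auto
  qed
  have "\<exists>Q q. basic_open X Q \<and> Q \<subseteq> U (p j) \<inter> U (p (Suc j)) \<and> q > 0 \<and>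
      (\<forall>s\<in>{0..1}. \<bar>s - real j / N\<bar> < q \<longrightarrow> \<gamma> s \<in> Q)" if j: "j \<in> {1..n}" for j
  proof -
    have s: "real j / N \<in> {0..1}"
      using j n by (simp add: divide_simps)
    have "\<gamma> (real j / N) \<in> U (p j) \<inter> U (p (Suc j))"
      using seg(1)[of j "real j / N"] seg(1)[of "Suc j" "real j / N"] j n s
      by (simp add: divide_right_mono)
    moreover have "openin (top_of_set X) (U (p j) \<inter> U (p (Suc j)))"
      using U(1) p(1) j n by (intro openin_Int) (auto simp: basic_open_def)
    ultimately obtain Q where Q: "basic_open X Q" "\<gamma> (real j / N) \<in> Q" "Q \<subseteq> U (p j) \<inter> U (p (Suc j))"
      using basic by blast
    then have "openin (top_of_set X) Q"
      by (simp add: basic_open_def)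
    then obtain q where "q > 0" "\<And>s. s \<in> {0..1} \<Longrightarrow> \<bar>s - real j / N\<bar> < q \<Longrightarrow> \<gamma> s \<in> Q"
      using path_preimage_ball[OF path _ s Q(2)] by blast
    then show ?thesis
      using Q by blast
  qed
  then obtain Q q where Q: "\<And>j. j \<in> {1..n} \<Longrightarrow> basic_open X (Q j)"
      "\<And>j. j \<in> {1..n} \<Longrightarrow> Q j \<subseteq> U (p j) \<inter> U (p (Suc j))"
    and q: "\<And>j. j \<in> {1..n} \<Longrightarrow> q j > 0"
      "\<And>j s. j \<in> {1..n} \<Longrightarrow> s \<in> {0..1} \<Longrightarrow> \<bar>s - real j / N\<bar> < q j \<Longrightarrow> \<gamma> s \<in> Q j"
    by metis
  \<comment> \<open>The even intervals will have radius \<open>r\<close> around the interior points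
    j/N. A third of the minimum makes \<open>r\<close> smaller than each \<open>q j\<close>, so that
    the path stays in \<open>Q j\<close>, and makes 2r smaller than 1/N, so that the odd intervals
    between them do not degenerate.\<close>
  define m where "m = Min (insert (1 / N) (q ` {1..n}))"
  define r where "r = m / 3"
  have "m > 0"
    unfolding m_def using q(1) N(1) by (subst Min_gr_iff) auto
  moreover have "m \<le> 1 / N"
    unfolding m_def by (intro Min_le) auto
  moreover have mq: "m \<le> q j" if "j \<in> {1..n}" for j
    unfolding m_def using that by (intro Min_le) auto
  ultimately have r: "r > 0" "3 * r \<le> 1 / N"
    by (simp_all add: r_def)
  have rq: "r < q j" if "j \<in> {1..n}" for j
    using mq[OF that] \<open>m > 0\<close> by (simp add: r_def)
  \<comment> \<open>The odd interval number 2j+1 is [\<open>lo j\<close>, \<open>hi j\<close>]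
    inside the segment ending at (j+1)/N, which explains the shift to \<open>p (Suc j)\<close>. The
    even interval number 2j is the gap around j/N. There are no gaps at 0 and 1, so the outermost
    odd intervals extend to the ends.\<close>
  define lo where "lo j = (if j = 0 then 0 else real j / N + r)" for j
  define hi where "hi j = (if j = n then 1 else real (Suc j) / N - r)" for j
  define a where "a i = (if even i then lo (i div 2) else hi (i div 2))" for i
  define W where "W i = (if even i then Q (i div 2) else U (p (Suc (i div 2))))" for i
  have lohi: "lo j < hi j" "real j / N \<le> lo j" "hi j \<le> real (Suc j) / N" if "j \<le> n" for j
  proof -
    have "real (Suc j) / N = real j / N + 1 / N" "j = n \<Longrightarrow> real j / N + 1 / N = 1"
      using n by (simp_all add: add_divide_distrib[symmetric])
    then show "lo j < hi j" "real j / N \<le> lo j" "hi j \<le> real (Suc j) / N"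
      using r that by (auto simp: lo_def hi_def)
  qed
  have hilo: "hi j = real (Suc j) / N - r" "lo (Suc j) = real (Suc j) / N + r" if "j < n" for j
    using that by (auto simp: lo_def hi_def)
  have ij: "(\<exists>j\<le>n. i = 2 * j + 1) \<or> (\<exists>j<n. i = 2 * Suc j)" if "i \<in> {1..2*n+1}" for i
  proof (cases "even i")
    case True
    then obtain k where "i = 2 * k" by blast
    then show ?thesis
      using that by (intro disjI2 exI[of _ "k - 1"]) auto
  next
    case False
    then obtain k where "i = 2 * k + 1" by (rule oddE)
    then show ?thesis
      using that by auto
  qed
  have aW: "a (2*j) = lo j" "a (2*j+1) = hi j" "W (2*j) = Q j" "W (2*j+1) = U (p (Suc j))" for j
    by (simp_all add: a_def W_def)
  define V where "V = path_nbhd X n a W"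
  have "basic_path_open X V (W 1) (W (2*n+1))"
    unfolding basic_path_open_def
  proof (intro exI[of _ n] exI[of _ a] exI[of _ W] conjI allI impI ballI)
    show "a 0 = 0" "a (2*n+1) = 1"
      by (simp_all add: a_def lo_def hi_def)
    show "a i < a (Suc i)" if "i \<le> 2*n" for i
    proof -
      have "Suc i \<in> {1..2*n+1}"
        using that by simp
      from ij[OF this] show ?thesis
      proof (elim disjE exE conjE)
        fix j assume "j \<le> n" "Suc i = 2 * j + 1"
        then show ?thesis
          using lohi(1) aW(1,2)[of j] by simp
      next
        fix j assume j: "j < n" "Suc i = 2 * Suc j"
        then have "i = 2 * j + 1"
          by simp
        then show ?thesis
          using hilo[OF j(1)] aW(2)[of j] aW(1)[of "Suc j"] r(1) by simp
      qed
    qed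
    show "basic_open X (W i)" if "i \<in> {1..2*n+1}" for i
      using ij[OF that]
    proof (elim disjE exE conjE)
      fix j assume "j \<le> n" "i = 2 * j + 1"
      then show ?thesis
        using U(1)[OF p(1)] n by (simp only: aW(4))
    next
      fix j assume "j < n" "i = 2 * Suc j"
      then show ?thesis
        using Q(1)[of "Suc j"] by (simp only: aW(3)) simp
    qed
    show "W (2*i) \<subseteq> W (2*i-1) \<inter> W (2*i+1)" if i: "i \<in> {1..n}" for i
    proof -
      obtain j where "i = Suc j"
        using i by (cases i) auto
      then show ?thesis
        using Q(2)[OF i] aW(3)[of i] aW(4)[of i] aW(4)[of j] by simp
    qed
  qed (simp_all add: V_def)
  moreover have "\<gamma> \<in> V"
    unfolding V_def path_nbhd_def
  proof (intro CollectI conjI path ballI image_subsetI)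
    fix i s assume "i \<in> {1..2*n+1}" and s: "s \<in> {a (i-1)..a i}"
    from ij[OF this(1)] show "\<gamma> s \<in> W i"
    proof (elim disjE exE conjE)
      fix j assume j: "j \<le> n" "i = 2 * j + 1"
      then have s': "real j / N \<le> s" "s \<le> real (Suc j) / N"
        using s aW(1,2)[of j] lohi[of j] by auto
      moreover have "real (Suc j) / N \<le> 1" "0 \<le> real j / N"
        using j n by simp_all
      ultimately have "s \<in> {0..1}"
        unfolding atLeastAtMost_iff by linarith
      then have "\<gamma> s \<in> U (p (Suc j))"
        using j n s' by (intro seg) auto
      then show ?thesis
        using j aW(4) by simp
    next
      fix j assume j: "j < n" "i = 2 * Suc j"
      then have "real (Suc j) / N - r \<le> s" "s \<le> real (Suc j) / N + r"
        using s aW(2)[of j] aW(1)[of "Suc j"] hilo[OF j(1)] by simp_all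
      then have s': "\<bar>s - real (Suc j) / N\<bar> \<le> r"
        by linarith
      moreover have "real (Suc j) / N \<le> 1 - 1 / N" "1 / N \<le> real (Suc j) / N"
        using j n by (simp_all add: divide_simps)
      ultimately have "s \<in> {0..1}"
        using r(1,2) unfolding atLeastAtMost_iff by linarith
      then show ?thesis
        using q(2)[of "Suc j" s] s' rq[of "Suc j"] j aW(3)[of "Suc j"] by simp
    qed
  qed
  moreover have "V \<subseteq> controlled_paths X R"
  proof
    fix \<eta> assume \<eta>: "\<eta> \<in> V"
    have "\<eta> s \<in> R s" if s: "s \<in> {0..1}" for s
    proof -
      have "a 0 \<le> s" "s \<le> a (2*n+1)"
        using s by (simp_all add: a_def lo_def hi_def)
      then obtain i where i: "i \<in> {1..2*n+1}" "s \<in> {a (i-1)..a i}"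
        using ex_interval_of_partition[of a s "2*n+1"] by auto
      then have "\<eta> s \<in> W i"
        using \<eta> unfolding V_def path_nbhd_def by blast
      from ij[OF i(1)] show ?thesis
      proof (elim disjE exE conjE)
        fix j assume j: "j \<le> n" "i = 2 * j + 1"
        then have "real j / N \<le> s" "s \<le> real (Suc j) / N"
          using i(2) aW(1,2)[of j] lohi[of j] by auto
        then have "U (p (Suc j)) \<subseteq> R s"
          using j n s by (intro seg) auto
        then show ?thesis
          using j aW(4) \<open>\<eta> s \<in> W i\<close> by auto
      next
        fix j assume j: "j < n" "i = 2 * Suc j"
        then have c: "real (Suc j) / N - r \<le> s" "s \<le> real (Suc j) / N + r"
          using i(2) aW(2)[of j] aW(1)[of "Suc j"] hilo[OF j(1)] by simp_all
        have k: "real j / N = real (Suc j) / N - 1 / N" "real (Suc (Suc j)) / N = real (Suc j) / N + 1 / N"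
          by (simp_all add: add_divide_distrib)
        have "y - k \<le> s \<and> s \<le> y + k" if "y - r \<le> s" "s \<le> y + r" "3 * r \<le> k" for y k
          using that r(1) by linarith
        from this[OF c r(2)] have s': "real j / N \<le> s" "s \<le> real (Suc (Suc j)) / N"
          unfolding k by blast+
        have "\<eta> s \<in> U (p (Suc j)) \<inter> U (p (Suc (Suc j)))"
          using Q(2)[of "Suc j"] j aW(3)[of "Suc j"] \<open>\<eta> s \<in> W i\<close> by auto
        \<comment> \<open>A time in a gap belongs to the segment on its left or on its right, and
          which one is not known in advance. This is why the even member was chosen inside both
          neighbouring sets.\<close>
        moreover have "U (p (Suc j)) \<subseteq> R s \<or> U (p (Suc (Suc j))) \<subseteq> R s"
        proof (cases "s \<le> real (Suc j) / N")
          case True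
          then show ?thesis
            using seg(2)[of "Suc j" s] s s' j n by simp
        next
          case False
          then show ?thesis
            using seg(2)[of "Suc (Suc j)" s] s s' j n by simp
        qed
        ultimately show ?thesis
          by blast
      qed
    qed
    then show "\<eta> \<in> controlled_paths X R"
      using \<eta> unfolding V_def path_nbhd_def controlled_paths_def by blast
  qed
  ultimately show ?thesis
    by (rule that)
qed

section \<open>Whiskering and reparametrization\<close>

text \<open>A Lebesgue number supplies one centre z for both (s,t) and (s',t). Then L(s',t) lies in
  the control at z, which is contained in the control at s.\<close>

lemma controlled_tube:
  assumes R: "path_control X R" and L: "continuous_on unit_square L" "L ` unit_square \<subseteq> X"
    and LR: "\<And>s t. s \<in> {0..1} \<Longrightarrow> t \<in> {0..1} \<Longrightarrow> L (s, t) \<in> R s"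
  obtains \<epsilon> where "\<epsilon> > 0"
    "\<And>s s' t. s \<in> {0..1} \<Longrightarrow> s' \<in> {0..1} \<Longrightarrow> t \<in> {0..1} \<Longrightarrow> \<bar>s' - s\<bar> \<le> \<epsilon> \<Longrightarrow> L (s', t) \<in> R s"
proof -
  have "\<exists>r>0. \<forall>w\<in>unit_square. dist w z < r \<longrightarrow> R (fst z) \<subseteq> R (fst w) \<and> L w \<in> R (fst z)"
    if z: "z \<in> unit_square" for z
  proof -
    have s: "fst z \<in> {0..1}"
      using z by auto
    then obtain d where d: "d > 0" "\<forall>s'\<in>{0..1}. \<bar>s' - fst z\<bar> < d \<longrightarrow> R (fst z) \<subseteq> R s'"
      and op: "openin (top_of_set X) (R (fst z))"
      using R unfolding path_control_def by blast
    have "openin (top_of_set unit_square) (unit_square \<inter> L -` R (fst z))"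
      using L op by (intro continuous_openin_preimage[of _ _ X]) (auto simp: image_subset_iff_funcset)
    moreover have "z \<in> unit_square \<inter> L -` R (fst z)"
      using z LR[of "fst z" "snd z"] by (simp add: mem_Times_iff)
    ultimately obtain e where e: "e > 0" "ball z e \<inter> unit_square \<subseteq> unit_square \<inter> L -` R (fst z)"
      unfolding openin_contains_ball by blast
    show ?thesis
    proof (intro exI[of _ "min d e"] conjI ballI impI)
      fix w assume w: "w \<in> unit_square" "dist w z < min d e"
      then have "\<bar>fst w - fst z\<bar> < d" "fst w \<in> {0..1}"
        using dist_fst_le[of w z] by (auto simp: dist_real_def)
      then show "R (fst z) \<subseteq> R (fst w)"
        using d(2) by blast
      have "w \<in> ball z e \<inter> unit_square"
        using w by (simp add: dist_commute)
      then show "L w \<in> R (fst z)"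
        using e(2) by blast
    qed (use d e in simp)
  qed
  then obtain r where r: "\<And>z. z \<in> unit_square \<Longrightarrow> r z > 0"
    "\<And>z w. z \<in> unit_square \<Longrightarrow> w \<in> unit_square \<Longrightarrow> dist w z < r z \<Longrightarrow> R (fst z) \<subseteq> R (fst w) \<and> L w \<in> R (fst z)"
    by metis
  have cover: "unit_square \<subseteq> \<Union>((\<lambda>z. ball z (r z)) ` unit_square)"
    using r(1) by force
  have "compact unit_square"
    by (intro compact_Times compact_Icc)
  then obtain e where e: "e > 0" "\<And>z. z \<in> unit_square \<Longrightarrow> \<exists>G\<in>(\<lambda>z. ball z (r z)) ` unit_square. ball z e \<subseteq> G"
    using Heine_Borel_lemma[OF _ cover] by blast
  show ?thesis
  proof (rule that[of "e / 2"])
    fix s s' t :: real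
    assume s: "s \<in> {0..1}" "s' \<in> {0..1}" "t \<in> {0..1}" "\<bar>s' - s\<bar> \<le> e / 2"
    have st: "(s, t) \<in> unit_square" "(s', t) \<in> unit_square"
      using s by simp_all
    obtain z where z: "z \<in> unit_square" "ball (s, t) e \<subseteq> ball z (r z)"
      using e(2)[OF st(1)] by blast
    have "dist (s', t) (s, t) = \<bar>s' - s\<bar>"
      by (simp add: dist_Pair_Pair dist_real_def)
    then have "(s, t) \<in> ball (s, t) e" "(s', t) \<in> ball (s, t) e"
      using s(4) e(1) by (simp_all add: dist_commute)
    then have "(s, t) \<in> ball z (r z)" "(s', t) \<in> ball z (r z)"
      using z(2) by blast+
    then have "dist (s, t) z < r z" "dist (s', t) z < r z"
      by (simp_all add: dist_commute)
    then show "L (s', t) \<in> R s"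
      using r(2)[OF z(1) st(1)] r(2)[OF z(1) st(2)] by auto
  qed (use e in simp)
qed

text \<open>The interval \<open>[-1, 2]\<close> is the common domain of all whiskerings of \<open>f\<close>: \<open>\<beta>0\<close> runs over
  \<open>[-1, 0]\<close>, \<open>f\<close> over \<open>[0, 1]\<close> and \<open>\<beta>1\<close> over \<open>[1, 2]\<close>.\<close>

definition extend :: "(real \<Rightarrow> 'a) \<Rightarrow> (real \<times> 'b \<Rightarrow> 'a) \<Rightarrow> (real \<Rightarrow> 'a) \<Rightarrow> real \<times> 'b \<Rightarrow> 'a"
  where "extend \<beta>0 f \<beta>1 = (\<lambda>(x, p).
    if x \<le> 0 then \<beta>0 (x + 1) else if x \<le> 1 then f (x, p) else \<beta>1 (x - 1))"

text \<open>The parameter set \<open>P\<close> is kept general for two uses: the interval of heights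
  t for a bigon, and the square of pairs (homotopy time, height) for a homotopy of bigons.\<close>

lemma extend_continuous:
  fixes f :: "real \<times> 'b::topological_space \<Rightarrow> 'a::topological_space"
  assumes "path \<beta>0" "path \<beta>1" and f: "continuous_on ({0..1} \<times> P) f"
    and ends: "\<And>p. p \<in> P \<Longrightarrow> f (0, p) = \<beta>0 1" "\<And>p. p \<in> P \<Longrightarrow> f (1, p) = \<beta>1 0"
  shows "continuous_on ({-1..2} \<times> P) (extend \<beta>0 f \<beta>1)"
proof -
  have \<beta>: "continuous_on {0..1} \<beta>0" "continuous_on {0..1} \<beta>1"
    using assms by (simp_all add: path_def)
  let ?D = "{-1..2::real} \<times> P"
  have "continuous_on {z \<in> ?D. fst z \<le> 0} (\<lambda>z. \<beta>0 (fst z + 1))"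
    by (rule continuous_on_compose2[OF \<beta>(1)]) (auto intro!: continuous_intros)
  moreover have "continuous_on {z \<in> {z \<in> ?D. 0 \<le> fst z}. fst z \<le> 1} f"
    by (rule continuous_on_subset[OF f]) auto
  moreover have "continuous_on {z \<in> {z \<in> ?D. 0 \<le> fst z}. 1 \<le> fst z} (\<lambda>z. \<beta>1 (fst z - 1))"
    by (rule continuous_on_compose2[OF \<beta>(2)]) (auto intro!: continuous_intros)
  ultimately have "continuous_on ?D
      (\<lambda>z. if fst z \<le> 0 then \<beta>0 (fst z + 1) else if fst z \<le> 1 then f z else \<beta>1 (fst z - 1))"
    by (intro continuous_on_cases_le) (auto intro!: continuous_intros simp: ends)
  also have "(\<lambda>z. if fst z \<le> 0 then \<beta>0 (fst z + 1) else if fst z \<le> 1 then f z else \<beta>1 (fst z - 1)) =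
      extend \<beta>0 f \<beta>1"
    by (auto simp: extend_def)
  finally show ?thesis .
qed

lemma extend_in:
  assumes "path_image \<beta>0 \<subseteq> X" "path_image \<beta>1 \<subseteq> X" "f ` ({0..1} \<times> P) \<subseteq> X" "x \<in> {-1..2}" "p \<in> P"
  shows "extend \<beta>0 f \<beta>1 (x, p) \<in> X"
proof -
  have "\<beta>0 (x + 1) \<in> X" if "x \<le> 0"
    using assms(1,4) that by (auto simp: path_image_def image_subset_iff)
  moreover have "f (x, p) \<in> X" if "0 < x" "x \<le> 1"
    using assms(3,5) that by (auto simp: image_subset_iff)
  moreover have "\<beta>1 (x - 1) \<in> X" if "1 < x"
    using assms(2,4) that by (auto simp: path_image_def image_subset_iff)
  ultimately show ?thesis
    by (auto simp: extend_def)
qed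

text \<open>The points \<open>x\<close> of \<open>[-1, 2]\<close> that a reparametrization with short excursions into \<open>[-1, 0]\<close> and
  \<open>[1, 2]\<close> may take at time \<open>s\<close>.\<close>

definition near_param :: "real \<Rightarrow> real \<Rightarrow> real \<Rightarrow> bool"
  where "near_param \<epsilon> s x \<longleftrightarrow> (\<epsilon> < s \<longrightarrow> s - \<epsilon> \<le> x) \<and> (s < 1 - \<epsilon> \<longrightarrow> x \<le> s + \<epsilon>)"

lemma near_param_mono: "near_param \<epsilon> s x \<Longrightarrow> \<epsilon> \<le> \<epsilon>' \<Longrightarrow> near_param \<epsilon>' s x"
  by (auto simp: near_param_def)

text \<open>Which of the two bounds are active depends only on s, and each active bound confines the
  parameter to a half-line.\<close>

lemma near_param_convex:
  assumes "near_param \<epsilon> s x" "near_param \<epsilon> s y" "u \<in> {0..1}"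
  shows "near_param \<epsilon> s ((1 - u) * x + u * y)"
proof -
  have "s - \<epsilon> \<le> (1 - u) * x + u * y" if "s - \<epsilon> \<le> x" "s - \<epsilon> \<le> y"
    using convexD_alt[of "{s - \<epsilon>..}" x y u] that assms(3) by simp
  moreover have "(1 - u) * x + u * y \<le> s + \<epsilon>" if "x \<le> s + \<epsilon>" "y \<le> s + \<epsilon>"
    using convexD_alt[of "{..s + \<epsilon>}" x y u] that assms(3) by simp
  ultimately show ?thesis
    using assms(1,2) by (auto simp: near_param_def)
qed

text \<open>A parameter x \<le> 0 is possible only for s \<le> \<epsilon>, where the control
  contains \<open>R 0\<close> by semicontinuity; likewise x > 1 forces s close to 1. For the
  remaining x the distance from s is at most \<epsilon>, and \<open>controlled_tube\<close>
  applies.\<close>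

lemma extend_controlled:
  assumes R: "path_control X R" and L: "continuous_on unit_square L" "L ` unit_square \<subseteq> X"
    and LR: "\<And>s t. s \<in> {0..1} \<Longrightarrow> t \<in> {0..1} \<Longrightarrow> L (s, t) \<in> R s"
    and \<beta>: "path_image \<beta>0 \<subseteq> R 0" "path_image \<beta>1 \<subseteq> R 1"
  obtains \<epsilon> where "\<epsilon> > 0"
    "\<And>s t x. s \<in> {0..1} \<Longrightarrow> t \<in> {0..1} \<Longrightarrow> x \<in> {-1..2} \<Longrightarrow> near_param \<epsilon> s x \<Longrightarrow>
      extend \<beta>0 L \<beta>1 (x, t) \<in> R s"
proof -
  obtain e where e: "e > 0"
    "\<And>s s' t. s \<in> {0..1} \<Longrightarrow> s' \<in> {0..1} \<Longrightarrow> t \<in> {0..1} \<Longrightarrow> \<bar>s' - s\<bar> \<le> e \<Longrightarrow> L (s', t) \<in> R s"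
    using controlled_tube[OF R L LR] by blast
  have "\<forall>s\<in>{0..1}. \<exists>d>0. \<forall>s'\<in>{0..1}. \<bar>s' - s\<bar> < d \<longrightarrow> R s \<subseteq> R s'"
    using R by (simp add: path_control_def)
  then obtain d0 d1 where d0: "d0 > 0" "\<forall>s\<in>{0..1}. \<bar>s - 0\<bar> < d0 \<longrightarrow> R 0 \<subseteq> R s"
    and d1: "d1 > 0" "\<forall>s\<in>{0..1}. \<bar>s - 1\<bar> < d1 \<longrightarrow> R 1 \<subseteq> R s"
    by (metis atLeastAtMost_iff order_refl zero_le_one)
  \<comment> \<open>The bound 1/3 keeps \<epsilon> below 1/2, so that for every s at least one of
    the two conditions in \<open>near_param\<close> is active. The halves turn the radii
    \<open>d0\<close> and \<open>d1\<close> into strict bounds.\<close>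
  define \<epsilon> where "\<epsilon> = min (min e (1/3)) (min (d0 / 2) (d1 / 2))"
  have \<epsilon>: "\<epsilon> > 0" "\<epsilon> \<le> e" "\<epsilon> < 1/2" "\<epsilon> < d0" "\<epsilon> < d1"
    using e(1) d0(1) d1(1) by (auto simp: \<epsilon>_def)
  show ?thesis
  proof (rule that[OF \<epsilon>(1)])
    fix s t x :: real
    assume s: "s \<in> {0..1}" "t \<in> {0..1}" "x \<in> {-1..2}" and near: "near_param \<epsilon> s x"
    have "\<beta>0 (x + 1) \<in> R s" if x: "x \<le> 0"
    proof -
      have "s \<le> \<epsilon>"
        using near x by (auto simp: near_param_def)
      then have "R 0 \<subseteq> R s"
        using d0(2) s(1) \<epsilon>(4) by simp
      then show ?thesis
        using \<beta>(1) x s(3) by (auto simp: path_image_def image_subset_iff)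
    qed
    moreover have "L (x, t) \<in> R s" if x: "0 < x" "x \<le> 1"
    proof -
      have "\<bar>x - s\<bar> \<le> \<epsilon>"
        using near x s(1) \<epsilon>(3) unfolding near_param_def atLeastAtMost_iff by linarith
      then show ?thesis
        using e(2) s x \<epsilon>(2) by simp
    qed
    moreover have "\<beta>1 (x - 1) \<in> R s" if x: "1 < x"
    proof -
      have "1 - \<epsilon> \<le> s"
        using near x by (auto simp: near_param_def)
      then have "R 1 \<subseteq> R s"
        using d1(2) s(1) \<epsilon>(5) by simp
      then show ?thesis
        using \<beta>(2) x s(3) by (auto simp: path_image_def image_subset_iff)
    qed
    ultimately show "extend \<beta>0 L \<beta>1 (x, t) \<in> R s"
      by (auto simp: extend_def)
  qed
qed

definition whisker :: "real \<Rightarrow> (real \<Rightarrow> 'a) \<Rightarrow> (real \<times> real \<Rightarrow> 'a) \<Rightarrow> (real \<Rightarrow> 'a) \<Rightarrow> real \<times> real \<Rightarrow> 'a"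
  where "whisker \<delta> \<beta>0 f \<beta>1 = hcomp_at (1 - \<delta>) (id_bigon \<beta>1) (hcomp_at \<delta> f (id_bigon \<beta>0))"

text \<open>The inner composite is run on [0, 1-\<delta>], so its break point \<delta> appears at
  \<delta>(1-\<delta>). The three resulting intervals are mapped affinely onto [-1,0], [0,1] and
  [1,2].\<close>

definition whisker_param :: "real \<Rightarrow> real \<Rightarrow> real"
  where "whisker_param \<delta> s = (if s \<le> \<delta> * (1 - \<delta>) then s / (\<delta> * (1 - \<delta>)) - 1
    else if s \<le> 1 - \<delta> then (s / (1 - \<delta>) - \<delta>) / (1 - \<delta>) else (s - (1 - \<delta>)) / \<delta> + 1)"

lemma whisker_eq_extend:
  assumes "0 < \<delta>" "\<delta> < 1"
  shows "whisker \<delta> \<beta>0 f \<beta>1 (s, t) = extend \<beta>0 f \<beta>1 (whisker_param \<delta> s, t)"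
proof -
  consider "s \<le> \<delta> * (1 - \<delta>)" | "\<delta> * (1 - \<delta>) < s" "s \<le> 1 - \<delta>" | "1 - \<delta> < s"
    by linarith
  then show ?thesis
  proof cases
    case 1
    moreover have "\<delta> * (1 - \<delta>) \<le> 1 - \<delta>"
      using assms by (simp add: mult_left_le_one_le)
    ultimately have "s \<le> 1 - \<delta>"
      by (rule order_trans)
    moreover have "s / (1 - \<delta>) \<le> \<delta>" "s / (\<delta> * (1 - \<delta>)) \<le> 1"
      using 1 assms by (simp_all add: divide_le_eq)
    ultimately show ?thesis
      using 1 by (simp add: whisker_def hcomp_at_def id_bigon_def extend_def whisker_param_def mult.commute)
  next
    case 2
    then have "\<delta> < s / (1 - \<delta>)" "s / (1 - \<delta>) \<le> 1"
      using assms by (simp_all add: less_divide_eq divide_le_eq)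
    then have "0 < (s / (1 - \<delta>) - \<delta>) / (1 - \<delta>)" "(s / (1 - \<delta>) - \<delta>) / (1 - \<delta>) \<le> 1"
      using assms by (simp_all add: divide_le_eq)
    then show ?thesis
      using 2 \<open>\<delta> < s / (1 - \<delta>)\<close>
      by (simp add: whisker_def hcomp_at_def id_bigon_def extend_def whisker_param_def)
  next
    case 3
    moreover have "\<delta> * (1 - \<delta>) \<le> 1 - \<delta>"
      using assms by (simp add: mult_left_le_one_le)
    moreover have "0 < (s - (1 - \<delta>)) / \<delta>"
      using 3 assms by simp
    ultimately show ?thesis
      by (simp add: whisker_def hcomp_at_def id_bigon_def extend_def whisker_param_def)
  qed
qed

lemma whisker_param_continuous:
  assumes "0 < \<delta>" "\<delta> < 1"
  shows "continuous_on S (whisker_param \<delta>)"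
proof -
  have "\<delta> * (1 - \<delta>) \<le> 1 - \<delta>"
    using assms by (simp add: mult_left_le_one_le)
  then have "continuous_on UNIV (whisker_param \<delta>)"
    unfolding whisker_param_def using assms
    by (intro continuous_on_cases_le continuous_intros) auto
  then show ?thesis
    by (rule continuous_on_subset) simp
qed

lemma whisker_param_ends:
  assumes "0 < \<delta>" "\<delta> < 1"
  shows "whisker_param \<delta> 0 = -1" "whisker_param \<delta> 1 = 2"
proof -
  have "\<delta> * (1 - \<delta>) < 1"
    using mult_strict_mono[of \<delta> 1 "1 - \<delta>" 1] assms by simp
  then show "whisker_param \<delta> 0 = -1" "whisker_param \<delta> 1 = 2"
    using assms by (simp_all add: whisker_param_def)
qed

lemma whisker_param_range:
  assumes "0 < \<delta>" "\<delta> < 1" "s \<in> {0..1}"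
  shows "whisker_param \<delta> s \<in> {-1..2}"
proof -
  consider "s \<le> \<delta> * (1 - \<delta>)" | "\<delta> * (1 - \<delta>) < s" "s \<le> 1 - \<delta>" | "1 - \<delta> < s" "\<not> s \<le> \<delta> * (1 - \<delta>)"
    by linarith
  then show ?thesis
  proof cases
    case 1
    then have "s / (\<delta> * (1 - \<delta>)) \<le> 1" "0 \<le> s / (\<delta> * (1 - \<delta>))"
      using assms by (simp_all add: divide_le_eq)
    then show ?thesis
      using 1 by (simp add: whisker_param_def)
  next
    case 2
    then have "\<delta> < s / (1 - \<delta>)" "s / (1 - \<delta>) \<le> 1"
      using assms by (simp_all add: less_divide_eq divide_le_eq)
    then have "0 < (s / (1 - \<delta>) - \<delta>) / (1 - \<delta>)" "(s / (1 - \<delta>) - \<delta>) / (1 - \<delta>) \<le> 1"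
      using assms by (simp_all add: divide_le_eq)
    then show ?thesis
      using 2 by (simp add: whisker_param_def)
  next
    case 3
    then have "0 \<le> (s - (1 - \<delta>)) / \<delta>" "(s - (1 - \<delta>)) / \<delta> \<le> 1"
      using assms by (simp_all add: divide_le_eq)
    then show ?thesis
      using 3 by (simp add: whisker_param_def)
  qed
qed

text \<open>On the middle piece the displacement from s has denominator (1-\<delta>)^2 \<ge> 1/4 and
  numerator of absolute value at most 2\<delta>, whence the constant 8. On the outer pieces s is
  within \<delta> of an end, so only the bound on the inner side is active.\<close>

lemma whisker_param_near:
  assumes \<delta>: "0 < \<delta>" "\<delta> \<le> 1/2" and s: "s \<in> {0..1}"
  shows "near_param (8 * \<delta>) s (whisker_param \<delta> s)"
proof -
  consider "s \<le> \<delta> * (1 - \<delta>)" | "\<delta> * (1 - \<delta>) < s" "s \<le> 1 - \<delta>" | "1 - \<delta> < s" "\<not> s \<le> \<delta> * (1 - \<delta>)"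
    by linarith
  then show ?thesis
  proof cases
    case 1
    moreover have "\<delta> * (1 - \<delta>) \<le> \<delta> * 1"
      using \<delta> by (intro mult_left_mono) auto
    ultimately have "s \<le> \<delta>"
      by linarith
    moreover have "s / (\<delta> * (1 - \<delta>)) \<le> 1"
      using 1 \<delta> by (simp add: divide_le_eq)
    then have "s / (\<delta> * (1 - \<delta>)) - 1 \<le> s + 8 * \<delta>"
      using \<delta>(1) s unfolding atLeastAtMost_iff by linarith
    ultimately show ?thesis
      using 1 s \<delta> by (simp add: near_param_def whisker_param_def)
  next
    case 2
    let ?c = "(1 - \<delta>) * (1 - \<delta>)"
    have c: "1/4 \<le> ?c"
      using mult_mono[of "1/2" "1 - \<delta>" "1/2" "1 - \<delta>"] \<delta> by simp
    have x: "(s / (1 - \<delta>) - \<delta>) / (1 - \<delta>) = (s - \<delta> * (1 - \<delta>)) / ?c"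
      using \<delta> by (simp add: field_simps)
    have "0 \<le> \<delta> * \<delta>" "\<delta> * \<delta> \<le> \<delta>" "s * \<delta> \<le> \<delta>" "0 \<le> s * \<delta>" "s * (\<delta> * \<delta>) \<le> \<delta> * \<delta>" "0 \<le> s * (\<delta> * \<delta>)"
      using \<delta> s by (simp_all add: mult_left_le_one_le mult_right_le_one_le)
    moreover have "s - \<delta> * (1 - \<delta>) - s * ?c = s * \<delta> + s * \<delta> - s * (\<delta> * \<delta>) - \<delta> + \<delta> * \<delta>"
      by (simp add: algebra_simps)
    moreover have "8 * \<delta> * (1/4) \<le> 8 * \<delta> * ?c"
      using c \<delta> by (intro mult_left_mono) auto
    ultimately have "s - \<delta> * (1 - \<delta>) - s * ?c \<le> 8 * \<delta> * ?c" "- (8 * \<delta> * ?c) \<le> s - \<delta> * (1 - \<delta>) - s * ?c"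
      by linarith+
    then have "(s - \<delta> * (1 - \<delta>)) \<le> (s + 8 * \<delta>) * ?c" "(s - 8 * \<delta>) * ?c \<le> s - \<delta> * (1 - \<delta>)"
      by (simp_all only: distrib_right left_diff_distrib)
    then have "(s - \<delta> * (1 - \<delta>)) / ?c \<le> s + 8 * \<delta>" "s - 8 * \<delta> \<le> (s - \<delta> * (1 - \<delta>)) / ?c"
      using c by (simp_all only: divide_le_eq le_divide_eq) auto
    then show ?thesis
      using 2 by (simp add: near_param_def whisker_param_def x)
  next
    case 3
    then have "0 \<le> (s - (1 - \<delta>)) / \<delta>"
      using \<delta> by simp
    then have "s - 8 * \<delta> \<le> (s - (1 - \<delta>)) / \<delta> + 1"
      using \<delta>(1) s unfolding atLeastAtMost_iff by linarith
    then show ?thesis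
      using 3 s \<delta> by (simp add: near_param_def whisker_param_def)
  qed
qed

lemma bigon_controlled_iff:
  assumes "bigon X L"
  shows "(\<forall>t\<in>{0..1}. (\<lambda>s. L (s, t)) \<in> controlled_paths X R) \<longleftrightarrow> (\<forall>s\<in>{0..1}. \<forall>t\<in>{0..1}. L (s, t) \<in> R s)"
proof -
  have "path (\<lambda>s. L (s, t))" "path_image (\<lambda>s. L (s, t)) \<subseteq> X" if "t \<in> {0..1}" for t
  proof -
    show "path (\<lambda>s. L (s, t))"
      unfolding path_def using that
      by (intro continuous_on_compose2[OF bigonD(1)[OF assms]] continuous_intros) auto
    show "path_image (\<lambda>s. L (s, t)) \<subseteq> X"
      using bigonD(2)[OF assms] that by (auto simp: path_image_def)
  qed
  then show ?thesis
    unfolding controlled_paths_def by blast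
qed

text \<open>The second coordinate is the time of the deformation from \<rho> to \<sigma>; the height
  in \<open>G\<close> is frozen at \<open>c\<close>. This is the surface swept out by one horizontal
  edge.\<close>

definition slide :: "(real \<times> real \<Rightarrow> 'a) \<Rightarrow> (real \<Rightarrow> real) \<Rightarrow> (real \<Rightarrow> real) \<Rightarrow> real \<Rightarrow> real \<times> real \<Rightarrow> 'a"
  where "slide G \<rho> \<sigma> c = (\<lambda>(s, u). G ((1 - u) * \<rho> s + u * \<sigma> s, c))"

lemma slide_in_segment:
  fixes x y u :: real
  assumes "u \<in> {0..1}"
  shows "(1 - u) * x + u * y \<in> closed_segment x y"
  using assms by (auto simp: in_segment)

lemma slide_bigon:
  assumes G: "continuous_on ({-1..2} \<times> {0..1}) G" "G ` ({-1..2} \<times> {0..1}) \<subseteq> X"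
    and \<rho>: "continuous_on {0..1} \<rho>" "\<rho> ` {0..1} \<subseteq> {-1..2}"
    and \<sigma>: "continuous_on {0..1} \<sigma>" "\<sigma> ` {0..1} \<subseteq> {-1..2}"
    and ends: "\<And>x. x \<in> closed_segment (\<rho> 0) (\<sigma> 0) \<Longrightarrow> G (x, c) = a"
      "\<And>x. x \<in> closed_segment (\<rho> 1) (\<sigma> 1) \<Longrightarrow> G (x, c) = b"
    and c: "c \<in> {0..1}"
  shows "bigon X (slide G \<rho> \<sigma> c)"
proof (rule bigonI)
  have range: "(1 - u) * \<rho> s + u * \<sigma> s \<in> {-1..2}" if "s \<in> {0..1}" "u \<in> {0..1}" for s u
  proof -
    have "closed_segment (\<rho> s) (\<sigma> s) \<subseteq> {-1..2}"
      using \<rho>(2) \<sigma>(2) that(1) by (intro closed_segment_subset) (auto simp: image_subset_iff)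
    then show ?thesis
      using slide_in_segment[OF that(2)] by blast
  qed
  have "continuous_on unit_square (\<lambda>z. \<rho> (fst z))" "continuous_on unit_square (\<lambda>z. \<sigma> (fst z))"
    by (rule continuous_on_compose2[OF \<rho>(1)] continuous_on_compose2[OF \<sigma>(1)]; auto intro!: continuous_intros)+
  then have "continuous_on unit_square (\<lambda>z. G ((1 - snd z) * \<rho> (fst z) + snd z * \<sigma> (fst z), c))"
    using range c by (intro continuous_on_compose2[OF G(1)] continuous_intros) auto
  then show "continuous_on unit_square (slide G \<rho> \<sigma> c)"
    by (simp add: slide_def split_def)
  show "slide G \<rho> \<sigma> c (s, u) \<in> X" if "s \<in> {0..1}" "u \<in> {0..1}" for s u
    using G(2) range[OF that] c by (auto simp: slide_def image_subset_iff)
  show "slide G \<rho> \<sigma> c (0, u) = a" "slide G \<rho> \<sigma> c (1, u) = b" if "u \<in> {0..1}" for u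
    using ends slide_in_segment[OF that] by (simp_all add: slide_def)
qed

lemma reparam_bigon:
  assumes G: "continuous_on ({-1..2} \<times> {0..1}) G" "G ` ({-1..2} \<times> {0..1}) \<subseteq> X"
    and \<rho>: "continuous_on {0..1} \<rho>" "\<rho> ` {0..1} \<subseteq> {-1..2}"
    and ends: "\<And>t. t \<in> {0..1} \<Longrightarrow> G (\<rho> 0, t) = a" "\<And>t. t \<in> {0..1} \<Longrightarrow> G (\<rho> 1, t) = b"
  shows "bigon X (\<lambda>(s, t). G (\<rho> s, t))"
proof (rule bigonI)
  have "continuous_on unit_square (\<lambda>z. \<rho> (fst z))"
    by (rule continuous_on_compose2[OF \<rho>(1)]; auto intro!: continuous_intros)
  then have "continuous_on unit_square (\<lambda>z. G (\<rho> (fst z), snd z))"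
    using \<rho>(2) by (intro continuous_on_compose2[OF G(1)] continuous_intros) auto
  then show "continuous_on unit_square (\<lambda>(s, t). G (\<rho> s, t))"
    by (simp add: split_def)
qed (use G(2) \<rho>(2) ends in \<open>auto simp: image_subset_iff\<close>)

text \<open>During a change of parametrization from \<open>\<rho>\<close> to \<open>\<sigma>\<close> the bottom and the top edge sweep out two
  bigons, which have to be added at the two ends.\<close>

lemma reparam_same_track:
  assumes G: "continuous_on ({-1..2} \<times> {0..1}) G" "G ` ({-1..2} \<times> {0..1}) \<subseteq> X"
    and \<rho>: "continuous_on {0..1} \<rho>" "\<rho> ` {0..1} \<subseteq> {-1..2}"
    and \<sigma>: "continuous_on {0..1} \<sigma>" "\<sigma> ` {0..1} \<subseteq> {-1..2}"
    and ends: "\<And>x t. x \<in> closed_segment (\<rho> 0) (\<sigma> 0) \<Longrightarrow> t \<in> {0..1} \<Longrightarrow> G (x, t) = a"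
      "\<And>x t. x \<in> closed_segment (\<rho> 1) (\<sigma> 1) \<Longrightarrow> t \<in> {0..1} \<Longrightarrow> G (x, t) = b"
  defines "B \<equiv> slide G \<rho> \<sigma> 0" and "T \<equiv> slide G \<sigma> \<rho> 1" and "k \<equiv> \<lambda>(s, t). G (\<sigma> s, t)"
  shows "bigon X B" "bigon X T" "bigon X k" "vcomposable k B" "vcomposable T k"
    "same_track X (\<lambda>(s, t). G (\<rho> s, t)) (vcomp T (vcomp k B))"
proof -
  show B: "bigon X B" and T: "bigon X T"
    unfolding B_def T_def using ends
    by (auto intro!: slide_bigon[OF G \<rho> \<sigma>] slide_bigon[OF G \<sigma> \<rho>] simp: closed_segment_commute)
  show k: "bigon X k"
    unfolding k_def using ends by (intro reparam_bigon[OF G \<sigma>]) auto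
  show kB: "vcomposable k B" and Tk: "vcomposable T k"
    by (simp_all add: vcomposable_def src1_def tgt1_def B_def T_def k_def slide_def)
  \<comment> \<open>The composite is also formed in the parameter rectangle, with the identity in
    place of \<open>G\<close>: up the bottom slide, through the new parametrization, and back along
    the top slide. Both sides then factor through \<open>G\<close>, and \<phi> and \<psi> are joined
    by straight lines in the rectangle.\<close>
  define \<phi> where "\<phi> z = (\<rho> (fst z), snd z)" for z :: "real \<times> real"
  define b0 where "b0 = slide (\<lambda>z. z) \<rho> \<sigma> 0"
  define b1 where "b1 = slide (\<lambda>z. z) \<sigma> \<rho> 1"
  define m where "m z = (\<sigma> (fst z), snd z)" for z :: "real \<times> real"
  define \<psi> where "\<psi> = vcomp b1 (vcomp m b0)"
  have cont: "continuous_on unit_square (\<lambda>z. \<rho> (fst z))" "continuous_on unit_square (\<lambda>z. \<sigma> (fst z))"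
    by (rule continuous_on_compose2[OF \<rho>(1)] continuous_on_compose2[OF \<sigma>(1)]; auto intro!: continuous_intros)+
  \<comment> \<open>For s = 0 and s = 1 this places the straight-line homotopy in a set on which
    \<open>G\<close> is constant, which settles the vertical sides.\<close>
  have seg: "\<psi> (s, t) \<in> closed_segment (\<rho> s) (\<sigma> s) \<times> {0..1}" if "t \<in> {0..1}" for s t
  proof -
    have "b0 (s, 2 * (2 * t)) \<in> closed_segment (\<rho> s) (\<sigma> s) \<times> {0..1}" if "2 * t \<le> 1/2"
      using slide_in_segment[of "2 * (2 * t)" "\<rho> s" "\<sigma> s"] \<open>t \<in> {0..1}\<close> that
      by (simp add: b0_def slide_def)
    moreover have "m (s, 2 * (2 * t) - 1) \<in> closed_segment (\<rho> s) (\<sigma> s) \<times> {0..1}"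
      if "t \<le> 1/2" "\<not> 2 * t \<le> 1/2"
      using that by (simp add: m_def)
    moreover have "b1 (s, 2 * t - 1) \<in> closed_segment (\<rho> s) (\<sigma> s) \<times> {0..1}" if "\<not> t \<le> 1/2"
      using slide_in_segment[of "2 * t - 1" "\<sigma> s" "\<rho> s"] \<open>t \<in> {0..1}\<close> that
      by (simp add: b1_def slide_def closed_segment_commute)
    ultimately show ?thesis
      by (simp add: \<psi>_def vcomp_def)
  qed
  show "same_track X (\<lambda>(s, t). G (\<rho> s, t)) (vcomp T (vcomp k B))"
  proof (rule same_track_convex[OF G, where \<phi> = \<phi> and \<psi> = \<psi>])
    show "convex ({-1..2::real} \<times> {0..1::real})"
      by (intro convex_Times convex_real_interval)
    show "continuous_on unit_square \<phi>"
      unfolding \<phi>_def using cont by (intro continuous_intros)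
    show "\<phi> ` unit_square \<subseteq> {-1..2} \<times> {0..1}"
      using \<rho>(2) by (auto simp: \<phi>_def)
    have "continuous_on unit_square m"
      unfolding m_def using cont by (intro continuous_intros)
    moreover have "continuous_on unit_square b0" "continuous_on unit_square b1"
      unfolding b0_def b1_def slide_def split_def by (intro continuous_intros cont)+
    moreover have "vcomposable m b0" "vcomposable b1 m"
      by (simp_all add: vcomposable_def src1_def tgt1_def b0_def b1_def m_def slide_def)
    ultimately show "continuous_on unit_square \<psi>"
      unfolding \<psi>_def by (intro vcomp_continuous) simp_all
    show "\<psi> ` unit_square \<subseteq> {-1..2} \<times> {0..1}"
    proof (rule image_subsetI)
      fix z :: "real \<times> real" assume z: "z \<in> unit_square"
      then have "closed_segment (\<rho> (fst z)) (\<sigma> (fst z)) \<subseteq> {-1..2}"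
        using \<rho>(2) \<sigma>(2) by (intro closed_segment_subset) (auto simp: image_subset_iff)
      then have sub: "closed_segment (\<rho> (fst z)) (\<sigma> (fst z)) \<times> {0..1} \<subseteq> {-1..2} \<times> {0..1}"
        by (rule Sigma_mono) simp
      have "\<psi> (fst z, snd z) \<in> closed_segment (\<rho> (fst z)) (\<sigma> (fst z)) \<times> {0..1}"
        using z by (intro seg) auto
      from subsetD[OF sub this] show "\<psi> z \<in> {-1..2} \<times> {0..1}"
        unfolding prod.collapse .
    qed
    show "bigon X (\<lambda>(s, t). G (\<rho> s, t))"
      using ends by (intro reparam_bigon[OF G \<rho>]) auto
    show "bigon X (vcomp T (vcomp k B))"
      using B T k kB Tk by (simp add: vcomp_bigon)
    show "(\<lambda>(s, t). G (\<rho> s, t)) z = G (\<phi> z)" for z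
      by (simp add: \<phi>_def split_def)
    show "vcomp T (vcomp k B) z = G (\<psi> z)" for z
      by (auto simp: \<psi>_def vcomp_def T_def k_def B_def b0_def b1_def m_def slide_def split_def)
    show "G ((1 - r) *\<^sub>R \<phi> z + r *\<^sub>R \<psi> z) = G (\<phi> z)" if r: "r \<in> {0..1}" and zb: "z \<in> square_boundary" for r z
    proof -
      obtain s t where z: "z = (s, t)"
        by (cases z)
      have st: "s \<in> {0..1}" "t \<in> {0..1}" "s \<in> {0,1} \<or> t \<in> {0,1}"
        using zb by (simp_all add: z mem_square_boundary)
      show ?thesis
      proof (cases "s \<in> {0,1}")
        case True
        let ?S = "closed_segment (\<rho> s) (\<sigma> s) \<times> {0..1::real}"
        have "convex ?S"
          by (intro convex_Times convex_real_interval convex_closed_segment)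
        moreover have \<phi>: "\<phi> z \<in> ?S"
          using st by (simp add: \<phi>_def z)
        ultimately have "(1 - r) *\<^sub>R \<phi> z + r *\<^sub>R \<psi> z \<in> ?S"
          using seg[OF st(2), of s] r by (intro convexD) (simp_all add: z)
        moreover have "\<exists>x. \<forall>w\<in>?S. G w = x"
          using True ends by auto
        ultimately show ?thesis
          using \<phi> by metis
      next
        case False
        \<comment> \<open>On the horizontal edges nothing moves: the bottom slide starts, and the
          top slide ends, with the old parametrization \<rho>.\<close>
        then have "\<psi> z = \<phi> z"
          using st(3) by (auto simp: z \<psi>_def \<phi>_def vcomp_def b0_def b1_def slide_def)
        then show ?thesis
          by (simp add: scaleR_left_distrib[symmetric])
      qed
    qed
  qed
qed

section \<open>Compatibility of whiskering with sums, homotopies and iteration\<close>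

lemma whisker_eq: "0 < \<delta> \<Longrightarrow> \<delta> < 1 \<Longrightarrow>
    whisker \<delta> \<beta>0 f \<beta>1 = (\<lambda>(s, t). extend \<beta>0 f \<beta>1 (whisker_param \<delta> s, t))"
  using whisker_eq_extend by fastforce

text \<open>This interchange law is an equality of functions, since the identity bigons at the two
  ends do not depend on t and so are unaffected by the split at t = 1/2.\<close>

lemma whisker_vcomp:
  "whisker \<delta> \<beta>0 (vcomp g f) \<beta>1 = vcomp (whisker \<delta> \<beta>0 g \<beta>1) (whisker \<delta> \<beta>0 f \<beta>1)"
  by (auto simp: whisker_def vcomp_def hcomp_at_def id_bigon_def)

lemma whisker_bigon:
  assumes f: "bigon X f" and \<beta>0: "path \<beta>0" "path_image \<beta>0 \<subseteq> X" "\<beta>0 1 = src0 f"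
    and \<beta>1: "path \<beta>1" "path_image \<beta>1 \<subseteq> X" "\<beta>1 0 = tgt0 f" and \<delta>: "0 < \<delta>" "\<delta> < 1"
  shows "bigon X (whisker \<delta> \<beta>0 f \<beta>1)"
  unfolding whisker_eq[OF \<delta>]
proof (rule reparam_bigon)
  show "continuous_on ({-1..2} \<times> {0..1}) (extend \<beta>0 f \<beta>1)"
    using \<beta>0 \<beta>1 bigonD[OF f] by (intro extend_continuous) auto
  show "extend \<beta>0 f \<beta>1 ` ({-1..2} \<times> {0..1}) \<subseteq> X"
    using extend_in[OF \<beta>0(2) \<beta>1(2) bigonD(2)[OF f]] by auto
  show "whisker_param \<delta> ` {0..1} \<subseteq> {-1..2}"
    using whisker_param_range[OF \<delta>] by blast
  show "extend \<beta>0 f \<beta>1 (whisker_param \<delta> 0, t) = \<beta>0 0" "extend \<beta>0 f \<beta>1 (whisker_param \<delta> 1, t) = \<beta>1 1" for t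
    by (simp_all add: whisker_param_ends[OF \<delta>] extend_def)
qed (rule whisker_param_continuous[OF \<delta>])

lemma whisker_same_track:
  assumes fg: "same_track X f g" and \<beta>0: "path \<beta>0" "path_image \<beta>0 \<subseteq> X" "\<beta>0 1 = src0 f"
    and \<beta>1: "path \<beta>1" "path_image \<beta>1 \<subseteq> X" "\<beta>1 0 = tgt0 f" and \<delta>: "0 < \<delta>" "\<delta> < 1"
  shows "same_track X (whisker \<delta> \<beta>0 f \<beta>1) (whisker \<delta> \<beta>0 g \<beta>1)"
proof -
  have f: "bigon X f" and g: "bigon X g"
    using fg by (simp_all add: same_track_def)
  have "src0 g = src0 f" "tgt0 g = tgt0 f"
    using same_track_boundary[OF fg] by (simp_all add: src0_def tgt0_def mem_square_boundary)
  then have wf: "bigon X (whisker \<delta> \<beta>0 f \<beta>1)" and wg: "bigon X (whisker \<delta> \<beta>0 g \<beta>1)"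
    using whisker_bigon[OF f \<beta>0 \<beta>1 \<delta>] whisker_bigon[OF g \<beta>0(1,2) _ \<beta>1(1,2) _ \<delta>] \<beta>0(3) \<beta>1(3) by auto
  obtain H where H: "continuous_on ({0..1::real} \<times> unit_square) H" "H ` ({0..1} \<times> unit_square) \<subseteq> X"
      "\<forall>z\<in>unit_square. H (0, z) = f z \<and> H (1, z) = g z" "\<forall>r\<in>{0..1}. \<forall>z\<in>square_boundary. H (r, z) = f z"
    using fg unfolding same_track_iff square_class_iff by blast
  \<comment> \<open>Moving x to the front makes the whole homotopy an argument for
    \<open>extend\<close>, with (r,t) as parameter.\<close>
  define K where "K = (\<lambda>(x, r, t). H (r, x, t))"
  have K: "continuous_on ({0..1} \<times> unit_square) K"
    unfolding K_def split_def by (rule continuous_on_compose2[OF H(1)]) (auto intro!: continuous_intros)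
  have KX: "K ` ({0..1} \<times> unit_square) \<subseteq> X"
    using H(2) by (auto simp: K_def image_subset_iff)
  have ends: "K (0, p) = \<beta>0 1" "K (1, p) = \<beta>1 0" if "p \<in> unit_square" for p
    using that H(4) \<beta>0(3) \<beta>1(3) bigonD(3,4)[OF f]
    by (auto simp: K_def mem_square_boundary)
  have E: "continuous_on ({-1..2} \<times> unit_square) (extend \<beta>0 K \<beta>1)"
    by (rule extend_continuous[OF \<beta>0(1) \<beta>1(1) K ends])
  have EX: "extend \<beta>0 K \<beta>1 (x, p) \<in> X" if "x \<in> {-1..2}" "p \<in> unit_square" for x p
    by (rule extend_in[OF \<beta>0(2) \<beta>1(2) KX that])
  have wp: "continuous_on ({0..1::real} \<times> unit_square) (\<lambda>p. whisker_param \<delta> (fst (snd p)))"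
    by (rule continuous_on_compose2[OF whisker_param_continuous[OF \<delta>, of UNIV]]) (auto intro!: continuous_intros)
  let ?H = "\<lambda>p. extend \<beta>0 K \<beta>1 (whisker_param \<delta> (fst (snd p)), fst p, snd (snd p))"
  have "whisker \<delta> \<beta>0 g \<beta>1 \<in> square_class X (whisker \<delta> \<beta>0 f \<beta>1)"
    unfolding square_class_iff
  proof (intro conjI exI[of _ ?H])
    show "continuous_on ({0..1::real} \<times> unit_square) ?H"
      by (rule continuous_on_compose2[OF E])
        (use whisker_param_range[OF \<delta>] in \<open>auto intro!: continuous_intros wp\<close>)
    show "?H ` ({0..1::real} \<times> unit_square) \<subseteq> X"
      using whisker_param_range[OF \<delta>] by (intro image_subsetI EX) auto
    \<comment> \<open>For fixed r and t only the row of \<open>H\<close> at height t enters. On a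
      horizontal edge of the square this row does not depend on r.\<close>
    have eq: "?H (r, s, t) = whisker \<delta> \<beta>0 e \<beta>1 (s, t)"
      if "\<And>x. x \<in> {0..1} \<Longrightarrow> H (r, x, t) = e (x, t)" for r s t and e :: "real \<times> real \<Rightarrow> 'a"
      using that by (simp add: whisker_eq_extend[OF \<delta>] extend_def K_def)
    show "\<forall>z\<in>unit_square. ?H (0, z) = whisker \<delta> \<beta>0 f \<beta>1 z \<and> ?H (1, z) = whisker \<delta> \<beta>0 g \<beta>1 z"
    proof
      fix z assume "z \<in> unit_square"
      then show "?H (0, z) = whisker \<delta> \<beta>0 f \<beta>1 z \<and> ?H (1, z) = whisker \<delta> \<beta>0 g \<beta>1 z"
        using H(3) eq[of 0 "snd z" f "fst z"] eq[of 1 "snd z" g "fst z"] by (simp add: mem_Times_iff)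
    qed
    show "\<forall>r\<in>{0..1}. \<forall>z\<in>square_boundary. ?H (r, z) = whisker \<delta> \<beta>0 f \<beta>1 z"
    proof (intro ballI)
      fix r :: real and z assume r: "r \<in> {0..1}" and zb: "z \<in> square_boundary"
      obtain s t where z: "z = (s, t)"
        by (cases z)
      have st: "t \<in> {0..1}" "s \<in> {0,1} \<or> t \<in> {0,1}"
        using zb by (simp_all add: z mem_square_boundary)
      show "?H (r, z) = whisker \<delta> \<beta>0 f \<beta>1 z"
      proof (cases "s \<in> {0,1}")
        case True
        then show ?thesis
          by (auto simp: z whisker_eq_extend[OF \<delta>] whisker_param_ends[OF \<delta>] extend_def)
      next
        case False
        then have "H (r, x, t) = f (x, t)" if "x \<in> {0..1}" for x
          using H(4) r st that by (simp add: mem_square_boundary)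
        then show ?thesis
          unfolding z using eq[of r t f s] by simp
      qed
    qed
  qed
  then show ?thesis
    unfolding same_track_iff using wf wg by blast
qed

text \<open>\<open>joinpaths\<close> runs each path in half the time: the old \<beta>0 becomes the
  second half of the joined left path, over [-1/2,0], and the old \<beta>1 the first half of the
  joined right path, over [1,3/2].\<close>

definition squeeze_param :: "real \<Rightarrow> real"
  where "squeeze_param y = (if y \<le> 0 then y / 2 else if y \<le> 1 then y else (1 + y) / 2)"

text \<open>A whiskering with break parameter \<open>\<delta>'\<close> of a whiskering with break parameter \<open>\<delta>\<close> is a whiskering by the
  joined paths, up to this reparametrization.\<close>

definition whisker_param2 :: "real \<Rightarrow> real \<Rightarrow> real \<Rightarrow> real"
  where "whisker_param2 \<delta> \<delta>' s = (let x = whisker_param \<delta>' s in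
    if x \<le> 0 then (x - 1) / 2 else if x \<le> 1 then squeeze_param (whisker_param \<delta> x) else x / 2 + 1)"

lemma whisker_whisker:
  assumes \<delta>: "0 < \<delta>" "\<delta> < 1" and \<delta>': "0 < \<delta>'" "\<delta>' < 1"
    and join: "\<beta>0' 1 = \<beta>0 0" "\<beta>1 1 = \<beta>1' 0"
  shows "whisker \<delta>' \<beta>0' (whisker \<delta> \<beta>0 f \<beta>1) \<beta>1' (s, t) =
    extend (\<beta>0' +++ \<beta>0) f (\<beta>1 +++ \<beta>1') (whisker_param2 \<delta> \<delta>' s, t)"
proof -
  define x where "x = whisker_param \<delta>' s"
  let ?G = "extend (\<beta>0' +++ \<beta>0) f (\<beta>1 +++ \<beta>1')"
  have lhs: "whisker \<delta>' \<beta>0' (whisker \<delta> \<beta>0 f \<beta>1) \<beta>1' (s, t) = extend \<beta>0' (whisker \<delta> \<beta>0 f \<beta>1) \<beta>1' (x, t)"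
    by (simp add: whisker_eq_extend[OF \<delta>'] x_def)
  consider "x \<le> 0" | "0 < x" "x \<le> 1" | "1 < x"
    by linarith
  then have "extend \<beta>0' (whisker \<delta> \<beta>0 f \<beta>1) \<beta>1' (x, t) = ?G (whisker_param2 \<delta> \<delta>' s, t)"
  proof cases
    case 1
    then have "whisker_param2 \<delta> \<delta>' s = (x - 1) / 2"
      by (simp add: whisker_param2_def x_def)
    moreover have "2 * ((x - 1) / 2 + 1) = x + 1" "(x - 1) / 2 + 1 \<le> 1 / 2" "(x - 1) / 2 \<le> 0"
      using 1 by (simp_all add: field_simps)
    ultimately show ?thesis
      using 1 by (simp only: extend_def joinpaths_def prod.case if_True)
  next
    case 2
    define y where "y = whisker_param \<delta> x"
    have y: "y \<in> {-1..2}"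
      unfolding y_def using 2 \<delta> by (intro whisker_param_range) auto
    have p: "whisker_param2 \<delta> \<delta>' s = squeeze_param y"
      using 2 by (simp add: whisker_param2_def x_def[symmetric] y_def)
    have l: "extend \<beta>0' (whisker \<delta> \<beta>0 f \<beta>1) \<beta>1' (x, t) = extend \<beta>0 f \<beta>1 (y, t)"
      using 2 by (simp add: extend_def[of \<beta>0'] whisker_eq_extend[OF \<delta>] y_def)
    \<comment> \<open>The value -1 goes to the midpoint of the joined left path, where
      \<open>joinpaths\<close> takes its first branch; the two values are matched there by
      \<open>join\<close>.\<close>
    consider "y = -1" | "-1 < y" "y \<le> 0" | "0 < y" "y \<le> 1" | "1 < y"
      using y by fastforce
    then show ?thesis
    proof cases
      case 1
      then show ?thesis
        unfolding p l by (simp add: squeeze_param_def extend_def joinpaths_def join)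
    next
      case 2
      then have "2 * (y / 2 + 1) - 1 = y + 1" "\<not> y / 2 + 1 \<le> 1 / 2"
        by simp_all
      then show ?thesis
        unfolding p l using 2 by (simp add: squeeze_param_def extend_def joinpaths_def add.commute)
    next
      case 3
      then show ?thesis
        unfolding p l by (simp add: squeeze_param_def extend_def)
    next
      case 4
      then have "2 * ((1 + y) / 2 - 1) = y - 1" "(1 + y) / 2 - 1 \<le> 1 / 2" "\<not> (1 + y) / 2 \<le> 0" "\<not> (1 + y) / 2 \<le> 1"
        using y by (simp_all add: field_simps)
      moreover have "squeeze_param y = (1 + y) / 2" "\<not> y \<le> 0" "\<not> y \<le> 1"
        using 4 by (simp_all add: squeeze_param_def)
      ultimately show ?thesis
        unfolding p l by (simp only: extend_def joinpaths_def prod.case if_True if_False)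
    qed
  next
    case 3
    then have "whisker_param2 \<delta> \<delta>' s = x / 2 + 1"
      by (simp add: whisker_param2_def x_def[symmetric])
    moreover have "2 * (x / 2 + 1 - 1) - 1 = x - 1" "\<not> x / 2 + 1 - 1 \<le> 1 / 2" "\<not> x / 2 + 1 \<le> 0" "\<not> x / 2 + 1 \<le> 1"
        "\<not> x \<le> 0" "\<not> x \<le> 1"
      using 3 by simp_all
    ultimately show ?thesis
      by (simp only: extend_def joinpaths_def prod.case if_False)
  qed
  then show ?thesis
    unfolding lhs .
qed

lemma whisker_param2_continuous:
  assumes \<delta>: "0 < \<delta>" "\<delta> < 1" and \<delta>': "0 < \<delta>'" "\<delta>' < 1"
  shows "continuous_on S (whisker_param2 \<delta> \<delta>')"
proof -
  have sq: "continuous_on UNIV squeeze_param"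
    unfolding squeeze_param_def by (intro continuous_on_cases_le continuous_intros) auto
  have "continuous_on UNIV (\<lambda>x. squeeze_param (whisker_param \<delta> x))"
    using whisker_param_continuous[OF \<delta>] by (intro continuous_on_compose2[OF sq]) auto
  then have c: "continuous_on A (\<lambda>x. squeeze_param (whisker_param \<delta> x))" for A
    by (rule continuous_on_subset) simp
  have ends: "squeeze_param (whisker_param \<delta> 0) = -1/2" "squeeze_param (whisker_param \<delta> 1) = 3/2"
    by (simp_all add: whisker_param_ends[OF \<delta>] squeeze_param_def)
  have "continuous_on UNIV
      (\<lambda>x. if x \<le> 0 then (x - 1) / 2 else if x \<le> 1 then squeeze_param (whisker_param \<delta> x) else x / 2 + 1)"
    using ends by (intro continuous_on_cases_le continuous_intros c) auto
  from continuous_on_compose2[OF this whisker_param_continuous[OF \<delta>', of S]] show ?thesis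
    by (simp add: whisker_param2_def[abs_def] Let_def)
qed

lemma whisker_param2_ends:
  assumes "0 < \<delta>'" "\<delta>' < 1"
  shows "whisker_param2 \<delta> \<delta>' 0 = -1" "whisker_param2 \<delta> \<delta>' 1 = 2"
  by (simp_all add: whisker_param2_def whisker_param_ends[OF assms])

lemma whisker_param2_range:
  assumes \<delta>: "0 < \<delta>" "\<delta> < 1" and \<delta>': "0 < \<delta>'" "\<delta>' < 1" and s: "s \<in> {0..1}"
  shows "whisker_param2 \<delta> \<delta>' s \<in> {-1..2}"
proof -
  define x where "x = whisker_param \<delta>' s"
  have x: "x \<in> {-1..2}"
    unfolding x_def by (rule whisker_param_range[OF \<delta>' s])
  have "squeeze_param (whisker_param \<delta> x) \<in> {-1..2}" if "0 < x" "x \<le> 1"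
    using whisker_param_range[OF \<delta>, of x] that by (auto simp: squeeze_param_def)
  then show ?thesis
    using x by (auto simp: whisker_param2_def x_def[symmetric] Let_def)
qed

text \<open>The displacement of the outer parametrization and that of the inner one add up.
  \<open>squeeze_param\<close> fixes [0,1] and only draws points outside towards it, so it violates
  neither active bound.\<close>

lemma whisker_param2_near:
  assumes \<delta>: "0 < \<delta>" "\<delta> \<le> 1/2" and \<delta>': "0 < \<delta>'" "\<delta>' \<le> 1/2" and s: "s \<in> {0..1}"
  shows "near_param (8 * \<delta> + 8 * \<delta>') s (whisker_param2 \<delta> \<delta>' s)"
proof -
  define x where "x = whisker_param \<delta>' s"
  have x: "near_param (8 * \<delta>') s x"
    unfolding x_def by (rule whisker_param_near[OF \<delta>' s])
  have s01: "0 \<le> s" "s \<le> 1"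
    using s by auto
  consider "x \<le> 0" | "0 < x" "x \<le> 1" | "1 < x"
    by linarith
  then show ?thesis
  proof cases
    case 1
    then have "whisker_param2 \<delta> \<delta>' s = (x - 1) / 2"
      by (simp add: whisker_param2_def x_def)
    then show ?thesis
      using x 1 \<delta> \<delta>' s01 by (simp add: near_param_def)
  next
    case 2
    define y where "y = whisker_param \<delta> x"
    have y: "near_param (8 * \<delta>) x y"
      unfolding y_def using 2 \<delta> by (intro whisker_param_near) auto
    have p: "whisker_param2 \<delta> \<delta>' s = squeeze_param y"
      using 2 by (simp add: whisker_param2_def x_def[symmetric] y_def)
    have "s - (8 * \<delta> + 8 * \<delta>') \<le> squeeze_param y" if "8 * \<delta> + 8 * \<delta>' < s"
    proof -
      \<comment> \<open>After losing 8\<delta>' the intermediate parameter still exceeds 8\<delta>,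
        which activates the lower bound for the inner parametrization.\<close>
      have "s - 8 * \<delta>' \<le> x"
        using x that \<delta> by (simp add: near_param_def)
      moreover from this have "x - 8 * \<delta> \<le> y"
        using y that by (simp add: near_param_def)
      ultimately show ?thesis
        using that s01 \<delta> \<delta>' by (simp add: squeeze_param_def)
    qed
    moreover have "squeeze_param y \<le> s + (8 * \<delta> + 8 * \<delta>')" if "s < 1 - (8 * \<delta> + 8 * \<delta>')"
    proof -
      have "x \<le> s + 8 * \<delta>'"
        using x that \<delta> by (simp add: near_param_def)
      moreover from this have "y \<le> x + 8 * \<delta>"
        using y that by (simp add: near_param_def)
      ultimately show ?thesis
        using that s01 \<delta> \<delta>' by (simp add: squeeze_param_def)
    qed
    ultimately show ?thesis
      unfolding p near_param_def by blast
  next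
    case 3
    then have "whisker_param2 \<delta> \<delta>' s = x / 2 + 1"
      by (simp add: whisker_param2_def x_def[symmetric])
    then show ?thesis
      using x 3 \<delta> \<delta>' s01 by (simp add: near_param_def)
  qed
qed

section \<open>Regrouping of sevenfold vertical composites\<close>

lemma vcomp_cong_right:
  "bigon X g \<Longrightarrow> vcomposable g f \<Longrightarrow> same_track X f f' \<Longrightarrow> same_track X (vcomp g f) (vcomp g f')"
  by (rule vcomp_same_track(2)[OF _ same_track_refl])

lemma vcomp_cong_left:
  "bigon X f \<Longrightarrow> vcomposable g f \<Longrightarrow> same_track X g g' \<Longrightarrow> same_track X (vcomp g f) (vcomp g' f)"
  by (rule vcomp_same_track(2)[OF same_track_refl])

text \<open>In the application \<open>w\<close> is the whiskered \<open>f\<close>, \<open>a0\<close>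
  and \<open>a1\<close> are its whiskered flanks, and \<open>b\<close> and \<open>t\<close> are the
  slides that turn the middle part \<open>K\<close> into the whiskering \<open>k\<close> of
  \<open>h\<close> with the prescribed break parameter. Everything below \<open>k\<close> is
  collected into one bigon for \<open>V0\<close>, everything above into one for \<open>V1\<close>.
  The missing composability facts follow because equal 2-tracks have equal edges.\<close>

lemma vcomp_regroup:
  assumes big: "bigon X l0" "bigon X a0" "bigon X b" "bigon X k" "bigon X t" "bigon X a1" "bigon X l1"
    and K: "same_track X K (vcomp t (vcomp k b))" and w: "same_track X w (vcomp a1 (vcomp K a0))"
    and comp: "vcomposable w l0" "vcomposable l1 w" "vcomposable K a0" "vcomposable a1 K"
      "vcomposable k b" "vcomposable t k"
  shows "vcomposable a0 l0" "vcomposable b a0" "vcomposable a1 t" "vcomposable l1 a1"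
    "same_track X (vcomp l1 (vcomp w l0)) (vcomp (vcomp (vcomp l1 a1) t) (vcomp k (vcomp b (vcomp a0 l0))))"
proof -
  let ?Z = "vcomp k (vcomp b (vcomp a0 l0))"
  show ba: "vcomposable b a0" and at: "vcomposable a1 t"
    using vcomp_same_track(1)[OF same_track_refl[OF big(2)] K comp(3)]
      vcomp_same_track(1)[OF K same_track_refl[OF big(6)] comp(4)] by simp_all
  show al: "vcomposable a0 l0" and la: "vcomposable l1 a1"
    using vcomp_same_track(1)[OF same_track_refl[OF big(1)] w comp(1)]
      vcomp_same_track(1)[OF w same_track_refl[OF big(7)] comp(2)] by simp_all
  note [simp] = big comp(5,6) ba at al la vcomp_bigon
  have "same_track X (vcomp K a0) (vcomp (vcomp t (vcomp k b)) a0)"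
    using K comp(3) by (intro vcomp_cong_left) simp_all
  also have "same_track X \<dots> (vcomp t (vcomp (vcomp k b) a0))"
    by (rule vcomp_assoc) simp_all
  also have "same_track X \<dots> (vcomp t (vcomp k (vcomp b a0)))"
    by (intro vcomp_cong_right vcomp_assoc) simp_all
  finally have "same_track X (vcomp a1 (vcomp K a0)) (vcomp a1 (vcomp t (vcomp k (vcomp b a0))))"
    using comp(4) by (intro vcomp_cong_right) simp_all
  with w have "same_track X w (vcomp a1 (vcomp t (vcomp k (vcomp b a0))))"
    by (rule same_track_trans)
  then have "same_track X (vcomp w l0) (vcomp (vcomp a1 (vcomp t (vcomp k (vcomp b a0)))) l0)"
    using comp(1) by (intro vcomp_cong_left) simp_all
  also have "same_track X \<dots> (vcomp a1 (vcomp (vcomp t (vcomp k (vcomp b a0))) l0))"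
    by (rule vcomp_assoc) simp_all
  also have "same_track X \<dots> (vcomp a1 (vcomp t (vcomp (vcomp k (vcomp b a0)) l0)))"
    by (intro vcomp_cong_right vcomp_assoc) simp_all
  also have "same_track X \<dots> (vcomp a1 (vcomp t (vcomp k (vcomp (vcomp b a0) l0))))"
    by (intro vcomp_cong_right vcomp_assoc) simp_all
  also have "same_track X \<dots> (vcomp a1 (vcomp t ?Z))"
    by (intro vcomp_cong_right vcomp_assoc) simp_all
  finally have "same_track X (vcomp l1 (vcomp w l0)) (vcomp l1 (vcomp a1 (vcomp t ?Z)))"
    using comp(2) by (intro vcomp_cong_right) simp_all
  also have "same_track X \<dots> (vcomp (vcomp l1 a1) (vcomp t ?Z))"
    by (rule same_track_sym, rule vcomp_assoc) simp_all
  also have "same_track X \<dots> (vcomp (vcomp (vcomp l1 a1) t) ?Z)"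
    by (rule same_track_sym, rule vcomp_assoc) simp_all
  finally show "same_track X (vcomp l1 (vcomp w l0)) (vcomp (vcomp (vcomp l1 a1) t) ?Z)" .
qed

section \<open>Neighbourhoods of 2-tracks\<close>

lemma controlled_pathsD: "\<eta> \<in> controlled_paths X R \<Longrightarrow> s \<in> {0..1} \<Longrightarrow> \<eta> s \<in> R s"
  by (simp add: controlled_paths_def)

lemma controlled_paths_cong:
  assumes "\<eta> \<in> controlled_paths X R" "\<And>s. s \<in> {0..1} \<Longrightarrow> \<eta> s = \<eta>' s"
  shows "\<eta>' \<in> controlled_paths X R"
proof -
  have "path \<eta>'"
    using assms unfolding controlled_paths_def path_def by (metis (mono_tags, lifting) continuous_on_cong mem_Collect_eq)
  moreover have "path_image \<eta>' = path_image \<eta>"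
    using assms(2) by (simp add: path_image_def)
  ultimately show ?thesis
    using assms by (auto simp: controlled_paths_def)
qed

lemma vcomp_in:
  assumes "\<And>t. t \<in> {0..1} \<Longrightarrow> f (s, t) \<in> S" "\<And>t. t \<in> {0..1} \<Longrightarrow> g (s, t) \<in> S" "t \<in> {0..1}"
  shows "vcomp g f (s, t) \<in> S"
  using assms(1)[of "2 * t"] assms(2)[of "2 * t - 1"] assms(3) by (auto simp: vcomp_def)

text \<open>Regarding the edge as a map that is constant in t reduces this to
  \<open>extend_controlled\<close>.\<close>

lemma edge_controlled:
  assumes R: "path_control X R" and h: "bigon X h" and c: "c \<in> {0..1}"
    and edge: "(\<lambda>s. h (s, c)) \<in> controlled_paths X R"
    and \<beta>: "path_image \<beta>0 \<subseteq> R 0" "path_image \<beta>1 \<subseteq> R 1"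
  obtains \<epsilon> where "\<epsilon> > 0"
    "\<And>s x. s \<in> {0..1} \<Longrightarrow> x \<in> {-1..2} \<Longrightarrow> near_param \<epsilon> s x \<Longrightarrow> extend \<beta>0 h \<beta>1 (x, c) \<in> R s"
proof -
  define L where "L = (\<lambda>(s, t::real). h (s, c))"
  have "continuous_on unit_square (\<lambda>z. h (fst z, c))"
    using c by (intro continuous_on_compose2[OF bigonD(1)[OF h]] continuous_intros) auto
  then have L: "continuous_on unit_square L"
    by (simp add: L_def split_def)
  have LX: "L ` unit_square \<subseteq> X"
    using bigonD(2)[OF h] c by (auto simp: L_def image_subset_iff)
  have LR: "L (s, t) \<in> R s" if "s \<in> {0..1}" for s t
    using edge that by (simp add: L_def controlled_paths_def)
  obtain \<epsilon> where \<epsilon>: "\<epsilon> > 0"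
    "\<And>s t x. s \<in> {0..1} \<Longrightarrow> t \<in> {0..1} \<Longrightarrow> x \<in> {-1..2} \<Longrightarrow> near_param \<epsilon> s x \<Longrightarrow>
      extend \<beta>0 L \<beta>1 (x, t) \<in> R s"
    using extend_controlled[OF R L LX LR \<beta>] by blast
  have "extend \<beta>0 L \<beta>1 (x, t) = extend \<beta>0 h \<beta>1 (x, c)" for x t
    by (simp add: extend_def L_def)
  then show ?thesis
    using \<epsilon>(2)[of _ 0] by (intro that[OF \<epsilon>(1)]) simp
qed

lemma slide_controlled:
  assumes near: "\<And>s x. s \<in> {0..1} \<Longrightarrow> x \<in> {-1..2} \<Longrightarrow> near_param \<epsilon> s x \<Longrightarrow> G (x, c) \<in> R s"
    and \<rho>: "\<And>s. s \<in> {0..1} \<Longrightarrow> \<rho> s \<in> {-1..2} \<and> near_param \<epsilon> s (\<rho> s)"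
    and \<sigma>: "\<And>s. s \<in> {0..1} \<Longrightarrow> \<sigma> s \<in> {-1..2} \<and> near_param \<epsilon> s (\<sigma> s)"
    and s: "s \<in> {0..1}" and u: "u \<in> {0..1}"
  shows "slide G \<rho> \<sigma> c (s, u) \<in> R s"
proof -
  have "closed_segment (\<rho> s) (\<sigma> s) \<subseteq> {-1..2}"
    using \<rho>[OF s] \<sigma>[OF s] by (intro closed_segment_subset) auto
  then have "(1 - u) * \<rho> s + u * \<sigma> s \<in> {-1..2}"
    using slide_in_segment[OF u] by blast
  moreover have "near_param \<epsilon> s ((1 - u) * \<rho> s + u * \<sigma> s)"
    using \<rho>[OF s] \<sigma>[OF s] u by (intro near_param_convex) auto
  ultimately show ?thesis
    using near[OF s] by (simp add: slide_def)
qed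

lemma whisker_controlled:
  assumes near: "\<And>s t x. s \<in> {0..1} \<Longrightarrow> t \<in> {0..1} \<Longrightarrow> x \<in> {-1..2} \<Longrightarrow> near_param \<epsilon> s x \<Longrightarrow>
      extend \<beta>0 L \<beta>1 (x, t) \<in> R s"
    and \<delta>: "0 < \<delta>" "\<delta> \<le> 1/2" "8 * \<delta> \<le> \<epsilon>" and s: "s \<in> {0..1}" "t \<in> {0..1}"
  shows "whisker \<delta> \<beta>0 L \<beta>1 (s, t) \<in> R s"
proof -
  have "near_param \<epsilon> s (whisker_param \<delta> s)"
    using near_param_mono[OF whisker_param_near[OF \<delta>(1,2) s(1)] \<delta>(3)] .
  moreover have "whisker_param \<delta> s \<in> {-1..2}"
    using \<delta> s by (intro whisker_param_range) auto
  ultimately show ?thesis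
    using near[OF s] \<delta> by (simp add: whisker_eq_extend)
qed

definition flanked :: "'a::topological_space set \<Rightarrow> (real \<Rightarrow> 'a) set \<Rightarrow> (real \<Rightarrow> 'a) set \<Rightarrow>
    (real \<times> real \<Rightarrow> 'a) \<Rightarrow> (real \<times> real \<Rightarrow> 'a) \<Rightarrow> (real \<times> real \<Rightarrow> 'a) \<Rightarrow> bool"
  where "flanked X V0 V1 L0 k L1 \<longleftrightarrow>
    bigon X L0 \<and> (\<forall>t\<in>{0..1}. (\<lambda>s. L0 (s, t)) \<in> V0) \<and>
    bigon X L1 \<and> (\<forall>t\<in>{0..1}. (\<lambda>s. L1 (s, t)) \<in> V1) \<and>
    vcomposable k L0 \<and> vcomposable L1 k"

lemma flankedI:
  assumes "bigon X L0" "\<And>s t. s \<in> {0..1} \<Longrightarrow> t \<in> {0..1} \<Longrightarrow> L0 (s, t) \<in> R0 s"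
    and "bigon X L1" "\<And>s t. s \<in> {0..1} \<Longrightarrow> t \<in> {0..1} \<Longrightarrow> L1 (s, t) \<in> R1 s"
    and "vcomposable k L0" "vcomposable L1 k"
  shows "flanked X (controlled_paths X R0) (controlled_paths X R1) L0 k L1"
  unfolding flanked_def
  using assms bigon_controlled_iff[OF assms(1), THEN iffD2] bigon_controlled_iff[OF assms(3), THEN iffD2]
  by simp

lemma flanked_controlled:
  assumes "flanked X (controlled_paths X R0) (controlled_paths X R1) L0 k L1" "s \<in> {0..1}" "t \<in> {0..1}"
  shows "L0 (s, t) \<in> R0 s" "L1 (s, t) \<in> R1 s"
  using assms bigon_controlled_iff[of X L0 R0] bigon_controlled_iff[of X L1 R1] by (simp_all add: flanked_def)

lemma mem_track_nbhd_iff: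
  "c \<in> track_nbhd X h U0 U1 V0 V1 \<longleftrightarrow> c \<in> two_tracks X \<and> (\<exists>\<beta>0 \<beta>1.
    path \<beta>0 \<and> path_image \<beta>0 \<subseteq> U0 \<and> \<beta>0 1 = src0 h \<and>
    path \<beta>1 \<and> path_image \<beta>1 \<subseteq> U1 \<and> \<beta>1 0 = tgt0 h \<and>
    (\<exists>d>0. \<forall>\<delta>>0. \<delta> < d \<longrightarrow> (\<exists>L0 L1. flanked X V0 V1 L0 (whisker \<delta> \<beta>0 h \<beta>1) L1 \<and>
      c = square_class X (vcomp L1 (vcomp (whisker \<delta> \<beta>0 h \<beta>1) L0)))))"
  unfolding track_nbhd_def eventually_at_right_field whisker_def flanked_def Let_def mem_Collect_eq
  by (simp only: conj_assoc)

lemma track_nbhd_mono: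
  assumes "U0 \<subseteq> U0'" "U1 \<subseteq> U1'" "V0 \<subseteq> V0'" "V1 \<subseteq> V1'"
  shows "track_nbhd X h U0 U1 V0 V1 \<subseteq> track_nbhd X h U0' U1' V0' V1'"
proof
  fix c assume c: "c \<in> track_nbhd X h U0 U1 V0 V1"
  have fl: "flanked X V0' V1' L0 k L1" if "flanked X V0 V1 L0 k L1" for L0 k L1
    using that assms(3,4) by (auto simp: flanked_def)
  obtain \<beta>0 \<beta>1 d where \<beta>: "path \<beta>0" "path_image \<beta>0 \<subseteq> U0" "\<beta>0 1 = src0 h"
    "path \<beta>1" "path_image \<beta>1 \<subseteq> U1" "\<beta>1 0 = tgt0 h" and d: "d > 0"
    "\<forall>\<delta>>0. \<delta> < d \<longrightarrow> (\<exists>L0 L1. flanked X V0 V1 L0 (whisker \<delta> \<beta>0 h \<beta>1) L1 \<and>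
      c = square_class X (vcomp L1 (vcomp (whisker \<delta> \<beta>0 h \<beta>1) L0)))"
    using c unfolding mem_track_nbhd_iff by blast
  have "\<exists>d>0. \<forall>\<delta>>0. \<delta> < d \<longrightarrow> (\<exists>L0 L1. flanked X V0' V1' L0 (whisker \<delta> \<beta>0 h \<beta>1) L1 \<and>
      c = square_class X (vcomp L1 (vcomp (whisker \<delta> \<beta>0 h \<beta>1) L0)))"
    using d fl by meson
  moreover have "path_image \<beta>0 \<subseteq> U0'" "path_image \<beta>1 \<subseteq> U1'"
    using \<beta> assms by auto
  ultimately show "c \<in> track_nbhd X h U0' U1' V0' V1'"
    using c \<beta> unfolding mem_track_nbhd_iff by blast
qed

text \<open>Edges are invariants of the class, so those of \<open>f\<close> can be read off the
  decomposition: its source and target paths are the outer edges of \<open>L0\<close> and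
  \<open>L1\<close>, and its end points are the outer ends of \<beta>0 and \<beta>1.\<close>

lemma flanked_facts:
  assumes f: "bigon X f" and h: "bigon X h" and \<beta>0: "path \<beta>0" "path_image \<beta>0 \<subseteq> X" "\<beta>0 1 = src0 h"
    and \<beta>1: "path \<beta>1" "path_image \<beta>1 \<subseteq> X" "\<beta>1 0 = tgt0 h" and \<delta>: "0 < \<delta>" "\<delta> < 1"
    and fl: "flanked X V0 V1 L0 (whisker \<delta> \<beta>0 h \<beta>1) L1"
    and eq: "square_class X f = square_class X (vcomp L1 (vcomp (whisker \<delta> \<beta>0 h \<beta>1) L0))"
  shows "same_track X f (vcomp L1 (vcomp (whisker \<delta> \<beta>0 h \<beta>1) L0))"
    "\<And>s. s \<in> {0..1} \<Longrightarrow> f (s, 0) = L0 (s, 0)" "\<And>s. s \<in> {0..1} \<Longrightarrow> f (s, 1) = L1 (s, 1)"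
    "src0 L0 = \<beta>0 0" "tgt0 L0 = \<beta>1 1" "src0 L1 = \<beta>0 0" "tgt0 L1 = \<beta>1 1" "src0 f = \<beta>0 0" "tgt0 f = \<beta>1 1"
proof -
  let ?k = "whisker \<delta> \<beta>0 h \<beta>1"
  have L: "bigon X L0" "bigon X L1" "vcomposable ?k L0" "vcomposable L1 ?k"
    using fl by (simp_all add: flanked_def)
  have k: "bigon X ?k"
    by (rule whisker_bigon[OF h \<beta>0 \<beta>1 \<delta>])
  have k01: "?k (0, t) = \<beta>0 0" "?k (1, t) = \<beta>1 1" for t
    by (simp_all add: whisker_eq_extend[OF \<delta>] whisker_param_ends[OF \<delta>] extend_def)
  show st: "same_track X f (vcomp L1 (vcomp ?k L0))"
    using f L k eq by (simp add: same_track_def vcomp_bigon)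
  show f0: "f (s, 0) = L0 (s, 0)" "f (s, 1) = L1 (s, 1)" if "s \<in> {0..1}" for s
  proof -
    have "(s, 0) \<in> square_boundary" "(s, 1) \<in> square_boundary"
      using that by (simp_all add: mem_square_boundary)
    then show "f (s, 0) = L0 (s, 0)" "f (s, 1) = L1 (s, 1)"
      using same_track_boundary[OF st] by (fastforce simp: vcomp_def)+
  qed
  have edges: "\<forall>s\<in>{0..1}. L0 (s, 1) = ?k (s, 0)" "\<forall>s\<in>{0..1}. ?k (s, 1) = L1 (s, 0)"
    using L(3,4) by (simp_all add: vcomposable_def src1_def tgt1_def)
  have "L0 (0, 1) = \<beta>0 0" "L0 (1, 1) = \<beta>1 1" "L1 (0, 0) = \<beta>0 0" "L1 (1, 0) = \<beta>1 1"
    using bspec[OF edges(1), of 0] bspec[OF edges(1), of 1] bspec[OF edges(2), of 0] bspec[OF edges(2), of 1] k01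
    by simp_all
  then show L01: "src0 L0 = \<beta>0 0" "tgt0 L0 = \<beta>1 1" and "src0 L1 = \<beta>0 0" "tgt0 L1 = \<beta>1 1"
    using bigonD(3,4)[OF L(1), of 1] by (simp_all add: src0_def[of L1] tgt0_def[of L1])
  show "src0 f = \<beta>0 0" "tgt0 f = \<beta>1 1"
    using f0(1) L01 by (simp_all add: src0_def tgt0_def)
qed

lemma admissible_controls:
  assumes "admissible X h U0 U1 V0 V1"
  obtains R0 R1 where "path_control X R0" "V0 = controlled_paths X R0" "path_control X R1" "V1 = controlled_paths X R1"
    "U0 \<subseteq> R0 0" "U0 \<subseteq> R1 0" "U1 \<subseteq> R0 1" "U1 \<subseteq> R1 1"
proof -
  obtain A0 B0 A1 B1 where V: "basic_path_open X V0 A0 B0" "basic_path_open X V1 A1 B1"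
    and U: "U0 \<subseteq> A0 \<inter> A1" "U1 \<subseteq> B0 \<inter> B1"
    using assms unfolding admissible_def by blast
  obtain R0 where "path_control X R0" "V0 = controlled_paths X R0" "R0 0 = A0" "R0 1 = B0"
    using basic_path_open_controlled[OF V(1)] .
  moreover obtain R1 where "path_control X R1" "V1 = controlled_paths X R1" "R1 0 = A1" "R1 1 = B1"
    using basic_path_open_controlled[OF V(2)] .
  ultimately show ?thesis
    using U that by blast
qed

text \<open>Constant \<beta>0 and \<beta>1 work, but the whiskered \<open>h\<close> still has other
  edges than \<open>h\<close>. The flanking bigons are the slides between the identity
  parametrization and \<open>whisker_param\<close>.\<close>

lemma square_class_in_track_nbhd:
  assumes h: "bigon X h" and adm: "admissible X h U0 U1 V0 V1"
  shows "square_class X h \<in> track_nbhd X h U0 U1 V0 V1"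
proof -
  define \<beta>0 where "\<beta>0 = (\<lambda>s::real. src0 h)"
  define \<beta>1 where "\<beta>1 = (\<lambda>s::real. tgt0 h)"
  obtain R0 R1 where R0: "path_control X R0" "V0 = controlled_paths X R0" and R1: "path_control X R1" "V1 = controlled_paths X R1"
    and U: "U0 \<subseteq> R0 0" "U0 \<subseteq> R1 0" "U1 \<subseteq> R0 1" "U1 \<subseteq> R1 1"
    using admissible_controls[OF adm] .
  have hU: "src0 h \<in> U0" "tgt0 h \<in> U1" and UX: "U0 \<subseteq> X" "U1 \<subseteq> X"
    and hV: "(\<lambda>s. h (s, 0)) \<in> V0" "(\<lambda>s. h (s, 1)) \<in> V1"
    using adm basic_open_subset unfolding admissible_def src1_def tgt1_def by blast+
  have \<beta>: "path \<beta>0" "path_image \<beta>0 \<subseteq> U0" "\<beta>0 1 = src0 h" "path \<beta>1" "path_image \<beta>1 \<subseteq> U1" "\<beta>1 0 = tgt0 h"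
    using hU by (auto simp: \<beta>0_def \<beta>1_def path_def path_image_def)
  have \<beta>R: "path_image \<beta>0 \<subseteq> R0 0" "path_image \<beta>1 \<subseteq> R0 1" "path_image \<beta>0 \<subseteq> R1 0" "path_image \<beta>1 \<subseteq> R1 1"
    using \<beta> U by auto
  have zero: "(0::real) \<in> {0..1}" and one: "(1::real) \<in> {0..1}"
    by simp_all
  let ?G = "extend \<beta>0 h \<beta>1"
  obtain \<epsilon>0 where \<epsilon>0: "\<epsilon>0 > 0" "\<And>s x. s \<in> {0..1} \<Longrightarrow> x \<in> {-1..2} \<Longrightarrow> near_param \<epsilon>0 s x \<Longrightarrow> ?G (x, 0) \<in> R0 s"
    using edge_controlled[OF R0(1) h zero hV(1)[unfolded R0(2)] \<beta>R(1,2)] by blast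
  obtain \<epsilon>1 where \<epsilon>1: "\<epsilon>1 > 0" "\<And>s x. s \<in> {0..1} \<Longrightarrow> x \<in> {-1..2} \<Longrightarrow> near_param \<epsilon>1 s x \<Longrightarrow> ?G (x, 1) \<in> R1 s"
    using edge_controlled[OF R1(1) h one hV(2)[unfolded R1(2)] \<beta>R(3,4)] by blast
  define d where "d = min (1/2) (min (\<epsilon>0 / 8) (\<epsilon>1 / 8))"
  have "\<exists>L0 L1. flanked X V0 V1 L0 (whisker \<delta> \<beta>0 h \<beta>1) L1 \<and>
      square_class X h = square_class X (vcomp L1 (vcomp (whisker \<delta> \<beta>0 h \<beta>1) L0))"
    if \<delta>: "0 < \<delta>" "\<delta> < d" for \<delta>
  proof -
    have \<delta>1: "\<delta> < 1" "\<delta> \<le> 1/2" "8 * \<delta> \<le> \<epsilon>0" "8 * \<delta> \<le> \<epsilon>1"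
      using \<delta> by (simp_all add: d_def)
    have wp: "whisker_param \<delta> s \<in> {-1..2} \<and> near_param e s (whisker_param \<delta> s)" if "s \<in> {0..1}" "8 * \<delta> \<le> e" for s e
      using whisker_param_range[OF \<delta>(1) \<delta>1(1) that(1)] near_param_mono[OF whisker_param_near[OF \<delta>(1) \<delta>1(2) that(1)] that(2)] by blast
    have idp: "s \<in> {-1..2} \<and> near_param e s s" if "s \<in> {0..1}" "0 < e" for s e :: real
      using that by (simp add: near_param_def)
    have G: "continuous_on ({-1..2} \<times> {0..1}) ?G"
      using \<beta> bigonD[OF h] by (intro extend_continuous) auto
    have GX: "?G ` ({-1..2} \<times> {0..1}) \<subseteq> X"
      using extend_in[OF order_trans[OF \<beta>(2) UX(1)] order_trans[OF \<beta>(5) UX(2)] bigonD(2)[OF h]] by auto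
    have id_range: "(\<lambda>s::real. s) ` {0..1} \<subseteq> {-1..2}"
      by auto
    have wp_range: "whisker_param \<delta> ` {0..1} \<subseteq> {-1..2}"
      using whisker_param_range[OF \<delta>(1) \<delta>1(1)] by blast
    \<comment> \<open>The start of the parametrization slides from 0 to -1, but the whole of [-1,0]
      is mapped to one point, so the slide is a bigon.\<close>
    have ends: "?G (x, t) = src0 h" if "x \<in> closed_segment 0 (whisker_param \<delta> 0)" "t \<in> {0..1}" for x t
      using that by (simp add: whisker_param_ends[OF \<delta>(1) \<delta>1(1)] closed_segment_eq_real_ivl extend_def \<beta>0_def)
    have ends': "?G (x, t) = tgt0 h" if "x \<in> closed_segment 1 (whisker_param \<delta> 1)" "t \<in> {0..1}" for x t
    proof -
      have "x \<ge> 1"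
        using that(1) by (simp add: whisker_param_ends[OF \<delta>(1) \<delta>1(1)] closed_segment_eq_real_ivl)
      then show ?thesis
        using bigonD(4)[OF h that(2)] by (cases "x = 1") (simp_all add: extend_def \<beta>1_def)
    qed
    note rep = reparam_same_track[OF G GX continuous_on_id id_range whisker_param_continuous[OF \<delta>(1) \<delta>1(1)] wp_range ends ends']
    let ?B = "slide ?G (\<lambda>s. s) (whisker_param \<delta>) 0" and ?T = "slide ?G (whisker_param \<delta>) (\<lambda>s. s) 1"
    have k: "(\<lambda>(s, t). ?G (whisker_param \<delta> s, t)) = whisker \<delta> \<beta>0 h \<beta>1"
      by (rule whisker_eq[OF \<delta>(1) \<delta>1(1), symmetric])
    have BR: "?B (s, u) \<in> R0 s" if s: "s \<in> {0..1}" and u: "u \<in> {0..1}" for s u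
    proof (rule slide_controlled[where G = ?G and c = 0 and R = R0 and \<epsilon> = \<epsilon>0, OF _ _ _ s u])
      show "?G (x, 0) \<in> R0 s" if "s \<in> {0..1}" "x \<in> {-1..2}" "near_param \<epsilon>0 s x" for s x
        by (rule \<epsilon>0(2)[OF that])
      show "s \<in> {-1..2} \<and> near_param \<epsilon>0 s s" if "s \<in> {0..1}" for s
        by (rule idp[OF that \<epsilon>0(1)])
      show "whisker_param \<delta> s \<in> {-1..2} \<and> near_param \<epsilon>0 s (whisker_param \<delta> s)" if "s \<in> {0..1}" for s
        by (rule wp[OF that \<delta>1(3)])
    qed
    have TR: "?T (s, u) \<in> R1 s" if s: "s \<in> {0..1}" and u: "u \<in> {0..1}" for s u
    proof (rule slide_controlled[where G = ?G and c = 1 and R = R1 and \<epsilon> = \<epsilon>1, OF _ _ _ s u])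
      show "?G (x, 1) \<in> R1 s" if "s \<in> {0..1}" "x \<in> {-1..2}" "near_param \<epsilon>1 s x" for s x
        by (rule \<epsilon>1(2)[OF that])
      show "whisker_param \<delta> s \<in> {-1..2} \<and> near_param \<epsilon>1 s (whisker_param \<delta> s)" if "s \<in> {0..1}" for s
        by (rule wp[OF that \<delta>1(4)])
      show "s \<in> {-1..2} \<and> near_param \<epsilon>1 s s" if "s \<in> {0..1}" for s
        by (rule idp[OF that \<epsilon>1(1)])
    qed
    have "flanked X V0 V1 ?B (whisker \<delta> \<beta>0 h \<beta>1) ?T"
      unfolding R0(2) R1(2) using rep(4,5) by (intro flankedI rep(1,2) BR TR) (simp_all add: k)
    moreover have "?G (s, t) = h (s, t)" if "s \<in> {0..1}" "t \<in> {0..1}" for s t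
      using that bigonD(3)[OF h that(2)] by (cases "s = 0") (simp_all add: extend_def \<beta>0_def)
    then have "same_track X h (\<lambda>(s, t). ?G (s, t))"
      by (intro same_track_cong[OF h]) auto
    from same_track_trans[OF this rep(6)] have "square_class X h = square_class X (vcomp ?T (vcomp (whisker \<delta> \<beta>0 h \<beta>1) ?B))"
      unfolding k same_track_def by blast
    ultimately show ?thesis
      by blast
  qed
  moreover have "d > 0"
    using \<epsilon>0(1) \<epsilon>1(1) by (simp add: d_def)
  moreover have "square_class X h \<in> two_tracks X"
    using h by (simp add: two_tracks_def)
  ultimately show ?thesis
    unfolding mem_track_nbhd_iff using \<beta> by blast
qed

text \<open>The path sets are chosen first, since \<open>U0\<close> and \<open>U1\<close> must fit
  into the end members of both chains. Those members are neighbourhoods of the end points because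
  the two edges of \<open>h\<close> lie in the path sets.\<close>

lemma ex_admissible:
  assumes X: "semilocally_2_connected X" and h: "bigon X h"
    and R0: "path_control X R0" "src1 h \<in> controlled_paths X R0"
    and R1: "path_control X R1" "tgt1 h \<in> controlled_paths X R1"
    and G0: "openin (top_of_set X) G0" "src0 h \<in> G0" and G1: "openin (top_of_set X) G1" "tgt0 h \<in> G1"
  obtains U0 U1 V0 V1 where "admissible X h U0 U1 V0 V1" "U0 \<subseteq> G0" "U1 \<subseteq> G1"
    "V0 \<subseteq> controlled_paths X R0" "V1 \<subseteq> controlled_paths X R1"
proof -
  obtain V0 A0 B0 where V0: "basic_path_open X V0 A0 B0" "src1 h \<in> V0" "V0 \<subseteq> controlled_paths X R0"
    using controlled_paths_basic[OF X R0] .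
  obtain V1 A1 B1 where V1: "basic_path_open X V1 A1 B1" "tgt1 h \<in> V1" "V1 \<subseteq> controlled_paths X R1"
    using controlled_paths_basic[OF X R1] .
  have ends: "h (0, 0) = src0 h" "h (1, 0) = tgt0 h" "h (0, 1) = src0 h" "h (1, 1) = tgt0 h"
    using bigonD(3,4)[OF h] by simp_all
  have "openin (top_of_set X) A0 \<and> openin (top_of_set X) B0 \<and> src0 h \<in> A0 \<and> tgt0 h \<in> B0"
  proof -
    obtain R where R: "path_control X R" "V0 = controlled_paths X R" "R 0 = A0" "R 1 = B0"
      using basic_path_open_controlled[OF V0(1)] .
    then have "src1 h 0 \<in> R 0" "src1 h 1 \<in> R 1"
      using controlled_pathsD V0(2) by fastforce+
    then show ?thesis
      using R by (auto simp: path_control_def src1_def ends)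
  qed
  moreover have "openin (top_of_set X) A1 \<and> openin (top_of_set X) B1 \<and> src0 h \<in> A1 \<and> tgt0 h \<in> B1"
  proof -
    obtain R where R: "path_control X R" "V1 = controlled_paths X R" "R 0 = A1" "R 1 = B1"
      using basic_path_open_controlled[OF V1(1)] .
    then have "tgt1 h 0 \<in> R 0" "tgt1 h 1 \<in> R 1"
      using controlled_pathsD V1(2) by fastforce+
    then show ?thesis
      using R by (auto simp: path_control_def tgt1_def ends)
  qed
  ultimately have op: "openin (top_of_set X) (G0 \<inter> (A0 \<inter> A1))" "src0 h \<in> G0 \<inter> (A0 \<inter> A1)"
      "openin (top_of_set X) (G1 \<inter> (B0 \<inter> B1))" "tgt0 h \<in> G1 \<inter> (B0 \<inter> B1)"
    using G0 G1 by (auto intro!: openin_Int)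
  have basic: "\<exists>U. basic_open X U \<and> x \<in> U \<and> U \<subseteq> G" if "openin (top_of_set X) G" "x \<in> G" for x G
    using X that openin_imp_subset[OF that(1)] unfolding semilocally_2_connected_def by blast
  obtain U0 where U0: "basic_open X U0" "src0 h \<in> U0" "U0 \<subseteq> G0 \<inter> (A0 \<inter> A1)"
    using basic[OF op(1,2)] by blast
  obtain U1 where U1: "basic_open X U1" "tgt0 h \<in> U1" "U1 \<subseteq> G1 \<inter> (B0 \<inter> B1)"
    using basic[OF op(3,4)] by blast
  have "admissible X h U0 U1 V0 V1"
    unfolding admissible_def using U0 U1 V0 V1 by blast
  then show ?thesis
    using U0(3) U1(3) V0(3) V1(3) by (intro that) auto
qed

text \<open>The intersection of two basic path sets is described by the pointwise intersection of
  their controls, and inside it there is again a basic path set around each of its members.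
  Monotonicity in all four arguments does the rest.\<close>

lemma ex_admissible_Int:
  assumes X: "semilocally_2_connected X" and h: "bigon X h"
    and adm: "admissible X h U0 U1 V0 V1" and adm': "admissible X h U0' U1' V0' V1'"
  obtains U0'' U1'' V0'' V1'' where "admissible X h U0'' U1'' V0'' V1''"
    "track_nbhd X h U0'' U1'' V0'' V1'' \<subseteq> track_nbhd X h U0 U1 V0 V1 \<inter> track_nbhd X h U0' U1' V0' V1'"
proof -
  obtain R0 R1 where R: "path_control X R0" "V0 = controlled_paths X R0" "path_control X R1" "V1 = controlled_paths X R1"
    using admissible_controls[OF adm] .
  obtain R0' R1' where R': "path_control X R0'" "V0' = controlled_paths X R0'" "path_control X R1'" "V1' = controlled_paths X R1'"
    using admissible_controls[OF adm'] .
  have op: "openin (top_of_set X) (U0 \<inter> U0')" "src0 h \<in> U0 \<inter> U0'" "openin (top_of_set X) (U1 \<inter> U1')" "tgt0 h \<in> U1 \<inter> U1'"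
    and V: "src1 h \<in> V0 \<inter> V0'" "tgt1 h \<in> V1 \<inter> V1'"
    using adm adm' unfolding admissible_def basic_open_def by (auto intro: openin_Int)
  obtain U0'' U1'' V0'' V1'' where q: "admissible X h U0'' U1'' V0'' V1''" "U0'' \<subseteq> U0 \<inter> U0'" "U1'' \<subseteq> U1 \<inter> U1'"
    "V0'' \<subseteq> V0 \<inter> V0'" "V1'' \<subseteq> V1 \<inter> V1'"
    using ex_admissible[OF X h path_control_Int[OF R(1) R'(1)] _ path_control_Int[OF R(3) R'(3)] _ op] V
    unfolding controlled_paths_Int R(2,4)[symmetric] R'(2,4)[symmetric] .
  then show ?thesis
    by (intro that[OF q(1)] Int_greatest track_nbhd_mono) auto
qed

lemma whisker_vcomposable:
  assumes "0 < \<delta>" "\<delta> < 1" "vcomposable g f"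
  shows "vcomposable (whisker \<delta> \<beta>0 g \<beta>1) (whisker \<delta> \<beta>0 f \<beta>1)"
  using assms(3) by (simp add: vcomposable_def src1_def tgt1_def whisker_eq_extend[OF assms(1,2)] extend_def)

text \<open>A single break parameter suffices, as only the boundary values of \<open>f\<close>
  matter.\<close>

lemma admissible_absorb:
  assumes f: "bigon X f" and h: "bigon X h" and adm: "admissible X h U0 U1 V0 V1"
    and fh: "square_class X f \<in> track_nbhd X h U0 U1 V0 V1"
  shows "admissible X f U0 U1 V0 V1"
proof -
  obtain R0 R1 where R0: "path_control X R0" "V0 = controlled_paths X R0" and R1: "path_control X R1" "V1 = controlled_paths X R1"
    using admissible_controls[OF adm] .
  have UX: "U0 \<subseteq> X" "U1 \<subseteq> X"
    using adm basic_open_subset unfolding admissible_def by blast+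
  obtain \<beta>0 \<beta>1 d where \<beta>0: "path \<beta>0" "path_image \<beta>0 \<subseteq> U0" "\<beta>0 1 = src0 h"
    and \<beta>1: "path \<beta>1" "path_image \<beta>1 \<subseteq> U1" "\<beta>1 0 = tgt0 h" and d: "d > 0"
    and wit: "\<forall>\<delta>>0. \<delta> < d \<longrightarrow> (\<exists>L0 L1. flanked X V0 V1 L0 (whisker \<delta> \<beta>0 h \<beta>1) L1 \<and>
      square_class X f = square_class X (vcomp L1 (vcomp (whisker \<delta> \<beta>0 h \<beta>1) L0)))"
    using fh unfolding mem_track_nbhd_iff by blast
  define \<delta> where "\<delta> = min d 1 / 2"
  have \<delta>: "0 < \<delta>" "\<delta> < 1" "\<delta> < d"
    using d by (auto simp: \<delta>_def)
  obtain L0 L1 where fl: "flanked X V0 V1 L0 (whisker \<delta> \<beta>0 h \<beta>1) L1"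
    and eq: "square_class X f = square_class X (vcomp L1 (vcomp (whisker \<delta> \<beta>0 h \<beta>1) L0))"
    using wit \<delta> by blast
  note facts = flanked_facts[OF f h \<beta>0(1) order_trans[OF \<beta>0(2) UX(1)] \<beta>0(3)
      \<beta>1(1) order_trans[OF \<beta>1(2) UX(2)] \<beta>1(3) \<delta>(1,2) fl eq]
  have "(\<lambda>s. L0 (s, 0)) \<in> V0" "(\<lambda>s. L1 (s, 1)) \<in> V1"
    using fl by (simp_all add: flanked_def)
  then have "src1 f \<in> V0" "tgt1 f \<in> V1"
    unfolding R0(2) R1(2) by (auto intro: controlled_paths_cong simp: src1_def tgt1_def facts(2,3))
  moreover have "src0 f \<in> U0" "tgt0 f \<in> U1"
    using \<beta>0(2) \<beta>1(2) by (auto simp: facts(8,9) path_image_def)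
  ultimately show ?thesis
    using adm unfolding admissible_def by blast
qed

text \<open>Whiskering a decomposition \<open>f = L1 + k + L0\<close> by paths in \<open>U0\<close> and \<open>U1\<close> keeps the whiskered \<open>L0\<close> and
  \<open>L1\<close> in \<open>V0\<close> and \<open>V1\<close> when the break parameter is small, and turns \<open>k\<close> into a whiskering of \<open>h\<close> by the
  joined paths. The change to another break parameter contributes two further bigons in \<open>V0\<close> and
  \<open>V1\<close>.\<close>

lemma track_nbhd_absorb:
  assumes f: "bigon X f" and h: "bigon X h" and adm: "admissible X h U0 U1 V0 V1"
    and fh: "square_class X f \<in> track_nbhd X h U0 U1 V0 V1"
  shows "track_nbhd X f U0 U1 V0 V1 \<subseteq> track_nbhd X h U0 U1 V0 V1"
proof
  fix c assume c: "c \<in> track_nbhd X f U0 U1 V0 V1"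
  obtain R0 R1 where R0: "path_control X R0" "V0 = controlled_paths X R0" and R1: "path_control X R1" "V1 = controlled_paths X R1"
    and U: "U0 \<subseteq> R0 0" "U0 \<subseteq> R1 0" "U1 \<subseteq> R0 1" "U1 \<subseteq> R1 1"
    using admissible_controls[OF adm] .
  have UX: "U0 \<subseteq> X" "U1 \<subseteq> X" and hV: "(\<lambda>s. h (s, 0)) \<in> V0" "(\<lambda>s. h (s, 1)) \<in> V1"
    using adm basic_open_subset unfolding admissible_def src1_def tgt1_def by blast+
  obtain \<beta>0 \<beta>1 d1 where \<beta>0: "path \<beta>0" "path_image \<beta>0 \<subseteq> U0" "\<beta>0 1 = src0 h"
    and \<beta>1: "path \<beta>1" "path_image \<beta>1 \<subseteq> U1" "\<beta>1 0 = tgt0 h" and d1: "d1 > 0"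
    and wit1: "\<forall>\<delta>>0. \<delta> < d1 \<longrightarrow> (\<exists>L0 L1. flanked X V0 V1 L0 (whisker \<delta> \<beta>0 h \<beta>1) L1 \<and>
      square_class X f = square_class X (vcomp L1 (vcomp (whisker \<delta> \<beta>0 h \<beta>1) L0)))"
    using fh unfolding mem_track_nbhd_iff by blast
  obtain \<gamma>0 \<gamma>1 d2 where \<gamma>0: "path \<gamma>0" "path_image \<gamma>0 \<subseteq> U0" "\<gamma>0 1 = src0 f"
    and \<gamma>1: "path \<gamma>1" "path_image \<gamma>1 \<subseteq> U1" "\<gamma>1 0 = tgt0 f" and d2: "d2 > 0"
    and wit2: "\<forall>\<delta>>0. \<delta> < d2 \<longrightarrow> (\<exists>L0 L1. flanked X V0 V1 L0 (whisker \<delta> \<gamma>0 f \<gamma>1) L1 \<and>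
      c = square_class X (vcomp L1 (vcomp (whisker \<delta> \<gamma>0 f \<gamma>1) L0)))"
    using c unfolding mem_track_nbhd_iff by blast
  note \<beta>X = order_trans[OF \<beta>0(2) UX(1)] order_trans[OF \<beta>1(2) UX(2)]
  note \<gamma>X = order_trans[OF \<gamma>0(2) UX(1)] order_trans[OF \<gamma>1(2) UX(2)]
  have facts: "same_track X f (vcomp L1 (vcomp (whisker \<delta> \<beta>0 h \<beta>1) L0))"
    "src0 L0 = \<beta>0 0" "tgt0 L0 = \<beta>1 1" "src0 L1 = \<beta>0 0" "tgt0 L1 = \<beta>1 1" "src0 f = \<beta>0 0" "tgt0 f = \<beta>1 1"
    if "0 < \<delta>" "\<delta> < 1" "flanked X V0 V1 L0 (whisker \<delta> \<beta>0 h \<beta>1) L1"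
      "square_class X f = square_class X (vcomp L1 (vcomp (whisker \<delta> \<beta>0 h \<beta>1) L0))" for \<delta> L0 L1
    using flanked_facts[OF f h \<beta>0(1) \<beta>X(1) \<beta>0(3) \<beta>1(1) \<beta>X(2) \<beta>1(3) that] by blast+
  \<comment> \<open>The outer ends of \<beta>0 and \<beta>1 are the end points of \<open>f\<close>,
    where \<gamma>0 and \<gamma>1 are attached.\<close>
  have join: "\<gamma>0 1 = \<beta>0 0" "\<beta>1 1 = \<gamma>1 0"
  proof -
    have \<delta>: "0 < min d1 1 / 2" "min d1 1 / 2 < 1" "min d1 1 / 2 < d1"
      using d1 by auto
    then obtain L0 L1 where "flanked X V0 V1 L0 (whisker (min d1 1 / 2) \<beta>0 h \<beta>1) L1"
      "square_class X f = square_class X (vcomp L1 (vcomp (whisker (min d1 1 / 2) \<beta>0 h \<beta>1) L0))"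
      using wit1 by blast
    from facts(6,7)[OF \<delta>(1,2) this] show "\<gamma>0 1 = \<beta>0 0" "\<beta>1 1 = \<gamma>1 0"
      using \<gamma>0(3) \<gamma>1(3) by simp_all
  qed
  define \<zeta>0 where "\<zeta>0 = \<gamma>0 +++ \<beta>0"
  define \<zeta>1 where "\<zeta>1 = \<beta>1 +++ \<gamma>1"
  have \<zeta>0: "path \<zeta>0" "path_image \<zeta>0 \<subseteq> U0" "\<zeta>0 1 = src0 h" 
    using \<beta>0 \<gamma>0 join by (simp_all add: \<zeta>0_def path_join_eq pathstart_def pathfinish_def subset_path_image_join)
      (simp add: joinpaths_def)
  have \<zeta>1: "path \<zeta>1" "path_image \<zeta>1 \<subseteq> U1" "\<zeta>1 0 = tgt0 h"
    using \<beta>1 \<gamma>1 join by (simp_all add: \<zeta>1_def path_join_eq pathstart_def pathfinish_def subset_path_image_join)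
      (simp add: joinpaths_def)
  note \<zeta>X = order_trans[OF \<zeta>0(2) UX(1)] order_trans[OF \<zeta>1(2) UX(2)]
  have zero: "(0::real) \<in> {0..1}" and one: "(1::real) \<in> {0..1}"
    by simp_all
  let ?G = "extend \<zeta>0 h \<zeta>1"
  obtain e0 where e0: "e0 > 0" "\<And>s x. s \<in> {0..1} \<Longrightarrow> x \<in> {-1..2} \<Longrightarrow> near_param e0 s x \<Longrightarrow> ?G (x, 0) \<in> R0 s"
    using edge_controlled[OF R0(1) h zero hV(1)[unfolded R0(2)] order_trans[OF \<zeta>0(2) U(1)] order_trans[OF \<zeta>1(2) U(3)]] by blast
  obtain e1 where e1: "e1 > 0" "\<And>s x. s \<in> {0..1} \<Longrightarrow> x \<in> {-1..2} \<Longrightarrow> near_param e1 s x \<Longrightarrow> ?G (x, 1) \<in> R1 s"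
    using edge_controlled[OF R1(1) h one hV(2)[unfolded R1(2)] order_trans[OF \<zeta>0(2) U(2)] order_trans[OF \<zeta>1(2) U(4)]] by blast
  define e where "e = min (min e0 e1) 1"
  have e: "0 < e" "e \<le> e0" "e \<le> e1" "e \<le> 1"
    using e0(1) e1(1) by (simp_all add: e_def)
  \<comment> \<open>The order of choices matters. The bound \<open>e\<close> comes from
    \<open>h\<close> and the joined paths alone, so \<delta>1 can be fixed before the flanks
    \<open>L0\<close> and \<open>L1\<close> are known. It uses up half of \<open>e\<close> and
    leaves the other half to \<delta>2.\<close>
  define \<delta>1 where "\<delta>1 = min (d1 / 2) (e / 16)"
  have \<delta>1: "0 < \<delta>1" "\<delta>1 < d1" "8 * \<delta>1 \<le> e / 2" "\<delta>1 < 1" "\<delta>1 \<le> 1/2"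
    using d1 e by (auto simp: \<delta>1_def)
  let ?k1 = "whisker \<delta>1 \<beta>0 h \<beta>1"
  obtain L0 L1 where fl1: "flanked X V0 V1 L0 ?k1 L1"
    and eq1: "square_class X f = square_class X (vcomp L1 (vcomp ?k1 L0))"
    using wit1 \<delta>1 by blast
  note facts1 = facts[OF \<delta>1(1,4) fl1 eq1]
  have L: "bigon X L0" "bigon X L1" and comp1: "vcomposable ?k1 L0" "vcomposable L1 ?k1"
    using fl1 by (simp_all add: flanked_def)
  have L0R: "L0 (s, t) \<in> R0 s" and L1R: "L1 (s, t) \<in> R1 s" if "s \<in> {0..1}" "t \<in> {0..1}" for s t
    using flanked_controlled[OF fl1[unfolded R0(2) R1(2)] that] by blast+
  obtain e0' where e0': "e0' > 0" "\<And>s t x. s \<in> {0..1} \<Longrightarrow> t \<in> {0..1} \<Longrightarrow> x \<in> {-1..2} \<Longrightarrow> near_param e0' s x \<Longrightarrow>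
      extend \<gamma>0 L0 \<gamma>1 (x, t) \<in> R0 s"
    using extend_controlled[OF R0(1) bigonD(1,2)[OF L(1)] L0R order_trans[OF \<gamma>0(2) U(1)] order_trans[OF \<gamma>1(2) U(3)]] by blast
  obtain e1' where e1': "e1' > 0" "\<And>s t x. s \<in> {0..1} \<Longrightarrow> t \<in> {0..1} \<Longrightarrow> x \<in> {-1..2} \<Longrightarrow> near_param e1' s x \<Longrightarrow>
      extend \<gamma>0 L1 \<gamma>1 (x, t) \<in> R1 s"
    using extend_controlled[OF R1(1) bigonD(1,2)[OF L(2)] L1R order_trans[OF \<gamma>0(2) U(2)] order_trans[OF \<gamma>1(2) U(4)]] by blast
  \<comment> \<open>Only now are \<open>L0\<close> and \<open>L1\<close> fixed, and \<delta>2 is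
    made small enough for their whiskerings to remain in \<open>V0\<close> and
    \<open>V1\<close>.\<close>
  define \<delta>2 where "\<delta>2 = min (min (d2 / 2) (e / 16)) (min (e0' / 8) (e1' / 8))"
  have \<delta>2: "0 < \<delta>2" "\<delta>2 < d2" "8 * \<delta>2 \<le> e / 2" "8 * \<delta>2 \<le> e0'" "8 * \<delta>2 \<le> e1'" "\<delta>2 < 1" "\<delta>2 \<le> 1/2"
    using d2 e e0'(1) e1'(1) by (auto simp: \<delta>2_def)
  let ?w = "\<lambda>g. whisker \<delta>2 \<gamma>0 g \<gamma>1"
  obtain l0 l1 where fl2: "flanked X V0 V1 l0 (?w f) l1" and eq2: "c = square_class X (vcomp l1 (vcomp (?w f) l0))"
    using wit2 \<delta>2 by blast
  have l: "bigon X l0" "bigon X l1" and comp2: "vcomposable (?w f) l0" "vcomposable l1 (?w f)"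
    using fl2 by (simp_all add: flanked_def)
  have l0R: "l0 (s, t) \<in> R0 s" and l1R: "l1 (s, t) \<in> R1 s" if "s \<in> {0..1}" "t \<in> {0..1}" for s t
    using flanked_controlled[OF fl2[unfolded R0(2) R1(2)] that] by blast+
  have wL: "bigon X (?w L0)" "bigon X (?w L1)"
    by (intro whisker_bigon L \<gamma>0(1) \<gamma>1(1) \<gamma>X \<delta>2(1,6); simp add: facts1 join)+
  have w0R: "?w L0 (s, t) \<in> R0 s" if "s \<in> {0..1}" "t \<in> {0..1}" for s t
    by (rule whisker_controlled[OF e0'(2) \<delta>2(1,7,4) that])
  have w1R: "?w L1 (s, t) \<in> R1 s" if "s \<in> {0..1}" "t \<in> {0..1}" for s t
    by (rule whisker_controlled[OF e1'(2) \<delta>2(1,7,5) that])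
  have wf: "same_track X (?w f) (vcomp (?w L1) (vcomp (?w ?k1) (?w L0)))"
    unfolding whisker_vcomp[symmetric]
    by (rule whisker_same_track[OF facts1(1) \<gamma>0(1) \<gamma>X(1) \<gamma>0(3) \<gamma>1(1) \<gamma>X(2) \<gamma>1(3) \<delta>2(1,6)])
  have comp3: "vcomposable (?w ?k1) (?w L0)" "vcomposable (?w L1) (?w ?k1)"
    using comp1 by (auto intro: whisker_vcomposable[OF \<delta>2(1,6)])
  have G: "continuous_on ({-1..2} \<times> {0..1}) ?G"
    using \<zeta>0 \<zeta>1 bigonD[OF h] by (intro extend_continuous) auto
  have GX: "?G ` ({-1..2} \<times> {0..1}) \<subseteq> X"
    using extend_in[OF \<zeta>X bigonD(2)[OF h]] by auto
  let ?r = "whisker_param2 \<delta>1 \<delta>2"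
  have r_cont: "continuous_on {0..1} ?r" and r_range: "?r ` {0..1} \<subseteq> {-1..2}"
    using whisker_param2_continuous[OF \<delta>1(1,4) \<delta>2(1,6)] whisker_param2_range[OF \<delta>1(1,4) \<delta>2(1,6)] by blast+
  have r_near: "?r s \<in> {-1..2} \<and> near_param e' s (?r s)" if "s \<in> {0..1}" "e \<le> e'" for s e'
  proof
    have "8 * \<delta>1 + 8 * \<delta>2 \<le> e'"
      using \<delta>1(3) \<delta>2(3) that(2) by linarith
    then show "near_param e' s (?r s)"
      by (rule near_param_mono[OF whisker_param2_near[OF \<delta>1(1,5) \<delta>2(1,7) that(1)]])
    show "?r s \<in> {-1..2}"
      by (rule whisker_param2_range[OF \<delta>1(1,4) \<delta>2(1,6) that(1)])
  qed
  have G_ends: "?G (-1, t) = \<zeta>0 0" "?G (2, t) = \<zeta>1 1" for t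
    by (simp_all add: extend_def)
  have K: "bigon X (\<lambda>(s, t). ?G (?r s, t))"
    by (rule reparam_bigon[OF G GX r_cont r_range]) (simp_all add: whisker_param2_ends[OF \<delta>2(1,6)] G_ends)
  \<comment> \<open>The iterated whiskering is a pullback of the same map ?G that defines the
    whiskerings of \<open>h\<close> by the joined paths, so the two can be compared by sliding
    parametrizations.\<close>
  have wk: "same_track X (?w ?k1) (\<lambda>(s, t). ?G (?r s, t))"
  proof -
    have "?w ?k1 (s, t) = ?G (?r s, t)" for s t
      unfolding \<zeta>0_def \<zeta>1_def by (rule whisker_whisker; fact)
    then have "?w ?k1 = (\<lambda>(s, t). ?G (?r s, t))"
      by (simp add: fun_eq_iff)
    then show ?thesis
      using same_track_refl[OF K] by simp
  qed
  have "\<exists>M0 M1. flanked X V0 V1 M0 (whisker \<delta> \<zeta>0 h \<zeta>1) M1 \<and>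
      c = square_class X (vcomp M1 (vcomp (whisker \<delta> \<zeta>0 h \<zeta>1) M0))"
    if \<delta>: "0 < \<delta>" "\<delta> < e / 8" for \<delta>
  proof -
    have \<delta>': "\<delta> < 1" "\<delta> \<le> 1/2" "8 * \<delta> \<le> e"
      using \<delta> e by simp_all
    let ?p = "whisker_param \<delta>" and ?k = "whisker \<delta> \<zeta>0 h \<zeta>1"
    have p_near: "?p s \<in> {-1..2} \<and> near_param e' s (?p s)" if "s \<in> {0..1}" "e \<le> e'" for s e'
      using whisker_param_range[OF \<delta>(1) \<delta>'(1) that(1)]
        near_param_mono[OF whisker_param_near[OF \<delta>(1) \<delta>'(2) that(1)] order_trans[OF \<delta>'(3) that(2)]] by blast
    have p_range: "?p ` {0..1} \<subseteq> {-1..2}"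
      using whisker_param_range[OF \<delta>(1) \<delta>'(1)] by blast
    have ends: "?G (x, t) = \<zeta>0 0" if "x \<in> closed_segment (?r 0) (?p 0)" "t \<in> {0..1}" for x t
      using that(1) by (simp add: whisker_param_ends[OF \<delta>(1) \<delta>'(1)] whisker_param2_ends[OF \<delta>2(1,6)] G_ends)
    have ends': "?G (x, t) = \<zeta>1 1" if "x \<in> closed_segment (?r 1) (?p 1)" "t \<in> {0..1}" for x t
      using that(1) by (simp add: whisker_param_ends[OF \<delta>(1) \<delta>'(1)] whisker_param2_ends[OF \<delta>2(1,6)] G_ends)
    let ?B = "slide ?G ?r ?p 0" and ?T = "slide ?G ?p ?r 1"
    note rep = reparam_same_track[OF G GX r_cont r_range whisker_param_continuous[OF \<delta>(1) \<delta>'(1)] p_range ends ends',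
        folded whisker_eq[OF \<delta>(1) \<delta>'(1)]]
    have BR: "?B (s, u) \<in> R0 s" if s: "s \<in> {0..1}" and u: "u \<in> {0..1}" for s u
    proof (rule slide_controlled[where G = ?G and c = 0 and R = R0 and \<epsilon> = e0, OF _ _ _ s u])
      show "?G (x, 0) \<in> R0 s" if "s \<in> {0..1}" "x \<in> {-1..2}" "near_param e0 s x" for s x
        by (rule e0(2)[OF that])
      show "?r s \<in> {-1..2} \<and> near_param e0 s (?r s)" if "s \<in> {0..1}" for s
        by (rule r_near[OF that e(2)])
      show "?p s \<in> {-1..2} \<and> near_param e0 s (?p s)" if "s \<in> {0..1}" for s
        by (rule p_near[OF that e(2)])
    qed
    have TR: "?T (s, u) \<in> R1 s" if s: "s \<in> {0..1}" and u: "u \<in> {0..1}" for s u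
    proof (rule slide_controlled[where G = ?G and c = 1 and R = R1 and \<epsilon> = e1, OF _ _ _ s u])
      show "?G (x, 1) \<in> R1 s" if "s \<in> {0..1}" "x \<in> {-1..2}" "near_param e1 s x" for s x
        by (rule e1(2)[OF that])
      show "?p s \<in> {-1..2} \<and> near_param e1 s (?p s)" if "s \<in> {0..1}" for s
        by (rule p_near[OF that e(3)])
      show "?r s \<in> {-1..2} \<and> near_param e1 s (?r s)" if "s \<in> {0..1}" for s
        by (rule r_near[OF that e(3)])
    qed
    note regroup = vcomp_regroup[OF l(1) wL(1) rep(1,3,2) wL(2) l(2) same_track_trans[OF wk rep(6)] wf
        comp2 comp3 rep(4,5)]
    \<comment> \<open>From bottom to top, the new lower flank is the outer flank, the whiskered
      inner flank and the slide; the new upper flank has them in the opposite order. Each piece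
      satisfies the control of its side pointwise, hence so does the sum.\<close>
    let ?M0 = "vcomp ?B (vcomp (?w L0) l0)" and ?M1 = "vcomp (vcomp l1 (?w L1)) ?T"
    have "flanked X (controlled_paths X R0) (controlled_paths X R1) ?M0 ?k ?M1"
    proof (rule flankedI)
      show "bigon X ?M0" "bigon X ?M1"
        using l wL rep(1,2) regroup(1-4) by (simp_all add: vcomp_bigon)
      show "vcomposable ?k ?M0" "vcomposable ?M1 ?k"
        using rep(4,5) by simp_all
      show "?M0 (s, t) \<in> R0 s" if "s \<in> {0..1}" "t \<in> {0..1}" for s t
        by (intro vcomp_in BR w0R l0R that)
      show "?M1 (s, t) \<in> R1 s" if "s \<in> {0..1}" "t \<in> {0..1}" for s t
        by (intro vcomp_in TR w1R l1R that)
    qed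
    moreover have "c = square_class X (vcomp ?M1 (vcomp ?k ?M0))"
      using regroup(5) eq2 by (simp add: same_track_def)
    ultimately show ?thesis
      unfolding R0(2) R1(2) by blast
  qed
  moreover have "0 < e / 8"
    using e(1) by simp
  moreover have "c \<in> two_tracks X"
    using c by (simp add: mem_track_nbhd_iff)
  ultimately show "c \<in> track_nbhd X h U0 U1 V0 V1"
    unfolding mem_track_nbhd_iff using \<zeta>0 \<zeta>1 by blast
qed

section \<open>The topology generated by the neighbourhoods\<close>

theorem lemma3p3:
  fixes X :: "'a::topological_space set"
  assumes "semilocally_2_connected X"
  shows "\<exists>!T. topspace T = two_tracks X \<and>
    (\<forall>h U0 U1 V0 V1. bigon X h \<and> admissible X h U0 U1 V0 V1 \<longrightarrow>
      openin T (track_nbhd X h U0 U1 V0 V1)) \<and>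
    (\<forall>h. bigon X h \<longrightarrow>
      nbhd_basis_at T (square_class X h)
        {track_nbhd X h U0 U1 V0 V1 | U0 U1 V0 V1. admissible X h U0 U1 V0 V1})"
proof -
  define N where "N h = {track_nbhd X h U0 U1 V0 V1 | U0 U1 V0 V1. admissible X h U0 U1 V0 V1}" for h
  \<comment> \<open>The neighbourhoods are indexed by bigons rather than by classes. Imposing the
    condition for every representative of every point avoids a separate proof that
    \<open>N h\<close> depends only on the class of \<open>h\<close>.\<close>
  define op where "op G \<longleftrightarrow> G \<subseteq> two_tracks X \<and>
    (\<forall>h. bigon X h \<and> square_class X h \<in> G \<longrightarrow> (\<exists>B\<in>N h. B \<subseteq> G))" for G
  have N_sub: "B \<subseteq> two_tracks X" if "B \<in> N h" for B h
    using that by (auto simp: N_def track_nbhd_def)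
  have N_I: "track_nbhd X h U0 U1 V0 V1 \<in> N h" if "admissible X h U0 U1 V0 V1" for h U0 U1 V0 V1
    using that unfolding N_def by blast
  have N_E: "\<exists>U0 U1 V0 V1. admissible X h U0 U1 V0 V1 \<and> B = track_nbhd X h U0 U1 V0 V1" if "B \<in> N h" for B h
    using that unfolding N_def by blast
  have N_self: "square_class X h \<in> B" if "bigon X h" "B \<in> N h" for B h
    using N_E[OF that(2)] square_class_in_track_nbhd[OF that(1)] by metis
  have N_absorb: "\<exists>C\<in>N f. C \<subseteq> B" if h: "bigon X h" and B: "B \<in> N h" and f: "bigon X f" "square_class X f \<in> B" for B h f
  proof -
    obtain U0 U1 V0 V1 where B': "admissible X h U0 U1 V0 V1" "B = track_nbhd X h U0 U1 V0 V1"
      using N_E[OF B] by metis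
    have fB: "square_class X f \<in> track_nbhd X h U0 U1 V0 V1"
      using f(2) B'(2) by simp
    show ?thesis
    proof (rule bexI)
      show "track_nbhd X f U0 U1 V0 V1 \<subseteq> B"
        unfolding B'(2) by (rule track_nbhd_absorb[OF f(1) h B'(1) fB])
      show "track_nbhd X f U0 U1 V0 V1 \<in> N f"
        by (rule N_I[OF admissible_absorb[OF f(1) h B'(1) fB]])
    qed
  qed
  have N_Int: "\<exists>D\<in>N h. D \<subseteq> B \<inter> C" if h: "bigon X h" and B: "B \<in> N h" and C: "C \<in> N h" for B C h
  proof -
    obtain U0 U1 V0 V1 where B': "admissible X h U0 U1 V0 V1" "B = track_nbhd X h U0 U1 V0 V1"
      using N_E[OF B] by metis
    obtain U0' U1' V0' V1' where C': "admissible X h U0' U1' V0' V1'" "C = track_nbhd X h U0' U1' V0' V1'"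
      using N_E[OF C] by metis
    obtain U0'' U1'' V0'' V1'' where D: "admissible X h U0'' U1'' V0'' V1''"
      "track_nbhd X h U0'' U1'' V0'' V1'' \<subseteq> B \<inter> C"
      using ex_admissible_Int[OF assms h B'(1) C'(1)] unfolding B'(2) C'(2) .
    show ?thesis
      using D(2) N_I[OF D(1)] by (rule bexI)
  qed
  have N_ex: "\<exists>B. B \<in> N h" if h: "bigon X h" for h
  proof -
    have "(\<lambda>s. h (s, t)) \<in> controlled_paths X (\<lambda>s. X)" if "t \<in> {0..1}" for t
      using bigon_controlled_iff[OF h, of "\<lambda>s. X", THEN iffD2] bigonD(2)[OF h] that
      by (auto simp: image_subset_iff)
    then have "src1 h \<in> controlled_paths X (\<lambda>s. X)" "tgt1 h \<in> controlled_paths X (\<lambda>s. X)"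
      by (simp_all add: src1_def tgt1_def)
    moreover have "src0 h \<in> X" "tgt0 h \<in> X"
      using bigonD(2)[OF h] by (auto simp: src0_def tgt0_def image_subset_iff)
    moreover have "openin (top_of_set X) X"
      by simp
    ultimately obtain U0 U1 V0 V1 where "admissible X h U0 U1 V0 V1"
      using ex_admissible[OF assms h path_control_const _ path_control_const] by metis
    then show ?thesis
      using N_I by blast
  qed
  have top: "istopology op"
    unfolding istopology_def
  proof (intro conjI allI impI)
    fix S T assume S: "op S" and T: "op T"
    show "op (S \<inter> T)"
      unfolding op_def
    proof (intro conjI allI impI)
      show "S \<inter> T \<subseteq> two_tracks X"
        using S by (auto simp: op_def)
      fix h assume h: "bigon X h \<and> square_class X h \<in> S \<inter> T"
      then obtain B C where "B \<in> N h" "B \<subseteq> S" "C \<in> N h" "C \<subseteq> T"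
        using S T unfolding op_def by blast
      then show "\<exists>B\<in>N h. B \<subseteq> S \<inter> T"
        using N_Int[of h B C] h by blast
    qed
  next
    fix \<K> assume K: "\<forall>K\<in>\<K>. op K"
    then show "op (\<Union>\<K>)"
      unfolding op_def
    proof (intro conjI allI impI)
      show "\<Union>\<K> \<subseteq> two_tracks X"
        using K by (auto simp: op_def)
      fix h assume h: "bigon X h \<and> square_class X h \<in> \<Union>\<K>"
      then obtain S where S: "S \<in> \<K>" "square_class X h \<in> S"
        by blast
      then obtain B where "B \<in> N h" "B \<subseteq> S"
        using K h unfolding op_def by metis
      then show "\<exists>B\<in>N h. B \<subseteq> \<Union>\<K>"
        using S(1) by blast
    qed
  qed
  \<comment> \<open>Absorption makes the basic sets themselves open: around each of its points a
    basic set contains one with the same quadruple.\<close>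
  have op_N: "op B" if "bigon X h" "B \<in> N h" for B h
    unfolding op_def using N_sub[OF that(2)] N_absorb[OF that] by simp
  let ?Q = "\<lambda>T. topspace T = two_tracks X \<and>
    (\<forall>h U0 U1 V0 V1. bigon X h \<and> admissible X h U0 U1 V0 V1 \<longrightarrow> openin T (track_nbhd X h U0 U1 V0 V1)) \<and>
    (\<forall>h. bigon X h \<longrightarrow> nbhd_basis_at T (square_class X h) (N h))"
  have "\<exists>!T. ?Q T"
  proof (rule ex1I)
    have "op (two_tracks X)"
      using N_ex N_sub unfolding op_def by (meson order_refl)
    then have "topspace (topology op) = two_tracks X"
      unfolding topspace_def topology_inverse'[OF top] by (auto simp: op_def)
    moreover have "openin (topology op) (track_nbhd X h U0 U1 V0 V1)"
      if "bigon X h" "admissible X h U0 U1 V0 V1" for h U0 U1 V0 V1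
      using op_N[OF that(1) N_I[OF that(2)]] by (simp only: topology_inverse'[OF top])
    moreover have "nbhd_basis_at (topology op) (square_class X h) (N h)" if "bigon X h" for h
      unfolding nbhd_basis_at_def topology_inverse'[OF top]
    proof (intro conjI ballI allI impI)
      fix B assume B: "B \<in> N h"
      show "\<exists>G. op G \<and> square_class X h \<in> G \<and> G \<subseteq> B"
        using op_N[OF that B] N_self[OF that B] by blast
    next
      fix G assume "op G \<and> square_class X h \<in> G"
      then show "\<exists>B\<in>N h. B \<subseteq> G"
        using that unfolding op_def by blast
    qed
    ultimately show "?Q (topology op)"
      by blast
  next
    fix T assume T: "?Q T"
    \<comment> \<open>The basis property at every point gives one direction. For the other, a set
      satisfying \<open>op\<close> contains around each point a basic set, and these are open in
      \<open>T\<close> by assumption.\<close>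
    have "openin T G \<longleftrightarrow> op G" for G
    proof
      assume G: "openin T G"
      then have "G \<subseteq> two_tracks X"
        using openin_subset T by metis
      moreover have "\<exists>B\<in>N h. B \<subseteq> G" if "bigon X h" "square_class X h \<in> G" for h
        using T that G unfolding nbhd_basis_at_def by blast
      ultimately show "op G"
        by (simp add: op_def)
    next
      assume G: "op G"
      show "openin T G"
      proof (subst openin_subopen, intro ballI)
        fix x assume x: "x \<in> G"
        then obtain h where h: "bigon X h" "x = square_class X h"
          using G unfolding op_def two_tracks_def by blast
        then obtain B where B: "B \<in> N h" "B \<subseteq> G"
          using G x unfolding op_def by blast
        then have "openin T B"
          using T h(1) N_E[OF B(1)] by metis
        then show "\<exists>S. openin T S \<and> x \<in> S \<and> S \<subseteq> G"
          using B h N_self[OF h(1) B(1)] by blast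
      qed
    qed
    then show "T = topology op"
      by (simp add: topology_eq topology_inverse'[OF top])
  qed
  then show ?thesis
    unfolding N_def .
qed

end
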